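(* Let $N=p_1p_2\cdots p_k$ for some primes $p_1<p_2<\dots<p_k$. Put $P_j:=p_1p_2\cdots p_j$ and assume that $$p_{j+1}>\left(\frac{P_j}{2}\right)^{P_j\varphi(P_j)/4}\qquad\text{for } j=1,\dots,k-1.$$ Then all principal minors of $\mathcal{F}_N$ are non-zero.
   Context: For $N\in\mathbb{N}$, the Fourier matrix is $\mathcal{F}_N=(\omega^{ij})_{0\le i,j\le N-1}\in\mathbb{C}^{N\times N}$ with $\omega=e^{-2\pi i/N}$, rows and columns indexed by $\mathbb{Z}_N=\{0,\dots,N-1\}$. A principal minor of $\mathcal{F}_N$ is the determinant of the submatrix with rows and columns both indexed by the same set $K\subset\mathbb{Z}_N$. $\varphi$ denotes Euler's totient function. *)

theory Defs
  imports
    Complex_Main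
    "HOL-Number_Theory.Totient"
    "Jordan_Normal_Form.Determinant"
    "Jordan_Normal_Form.DL_Submatrix"
begin

definition fourier_matrix :: "nat \<Rightarrow> complex mat" where
  "fourier_matrix N = mat N N (\<lambda>(i, j). exp (- 2 * of_real pi * \<i> / of_nat N) ^ (i * j))"

(* Intended for square A of dimension n and K \<subseteq> {0..<n}. The empty set gives the
   determinant of the 0 by 0 matrix, which is 1. *)
definition principal_minor :: "'a::comm_ring_1 mat \<Rightarrow> nat set \<Rightarrow> 'a" where
  "principal_minor A K = det (submatrix A K K)"

end

theory Submission
  imports
    "HOL-Analysis.Complex_Transcendental"
    Defs
    "Jordan_Normal_Form.Char_Poly"
    "Jordan_Normal_Form.Schur_Decomposition"
begin

text \<open>
  Induct on the number of primes and pass from \<open>M\<close> to \<open>M * p\<close>. By the Chinese remainder theorem a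
  primitive root of unity of order \<open>M * p\<close> is \<open>\<zeta> * \<xi>\<close> with \<open>\<zeta>\<close>, \<open>\<xi>\<close> primitive of orders \<open>M\<close>, \<open>p\<close>.
  A vanishing principal minor on \<open>K\<close> has a nonzero kernel vector \<open>v\<close> of algebraic integers, and it
  suffices to show that \<open>1 - \<xi>\<close> divides every such \<open>v\<close>: then all powers of \<open>1 - \<xi>\<close>, hence all powers
  of \<open>p\<close>, divide a nonzero integer.

  For \<open>x < M\<close> let \<open>h x\<close> be the polynomial with exponents \<open>b mod p\<close> and coefficients \<open>v b\<close>, where
  \<open>b \<in> K\<close> and \<open>b mod M = x\<close>, and let \<open>n x\<close> be the number of these \<open>b\<close>. The kernel condition gives the
  polynomial \<open>\<Sum>y<M. \<zeta> ^ (x * y) * h y\<close> \<open>n x\<close> distinct roots of the form \<open>\<xi> ^ a\<close>, all congruent to \<open>1\<close>,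
  so modulo \<open>1 - \<xi>\<close> its first \<open>n x\<close> Taylor coefficients at \<open>1\<close> vanish. By induction on \<open>l\<close> the \<open>l\<close>-th
  Taylor coefficient of every \<open>h x\<close> vanishes modulo \<open>1 - \<xi>\<close>: if \<open>n x \<le> l\<close> a Vandermonde argument
  already shows \<open>h x = 0\<close> modulo \<open>1 - \<xi>\<close>, and the remaining \<open>x\<close> form a set \<open>S\<close> on which the principal minor of the
  Fourier matrix of order \<open>M\<close> is invertible modulo \<open>1 - \<xi>\<close>.

  The invertibility is where the size of \<open>p\<close> enters. If \<open>S\<close> has at most \<open>M / 2\<close> elements, Hadamard's
  inequality bounds the norm of the minor, a nonzero integer, by \<open>(M / 2) powr (M * totient M / 4) < p\<close>.
  Fourier inversion reduces a larger \<open>S\<close> to its complement.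
\<close>

section \<open>The ring of algebraic integers\<close>

text \<open>\<open>z\<close> is an eigenvalue of an integer matrix, hence a root of its monic
  characteristic polynomial. The index type is arbitrary because the spanning family for sums and
  products is indexed by pairs.\<close>

lemma algebraic_int_eigenvalue:
  fixes z :: complex and v :: "'i \<Rightarrow> complex" and B :: "'i \<Rightarrow> 'i \<Rightarrow> int"
  assumes fin: "finite I" and nz: "i0 \<in> I" "v i0 \<noteq> 0"
    and eq: "\<And>i. i \<in> I \<Longrightarrow> z * v i = (\<Sum>j\<in>I. of_int (B i j) * v j)"
  shows "algebraic_int z"
proof -
  obtain e where e: "bij_betw e {0..<card I} I"
    using ex_bij_betw_nat_finite[OF fin] by blast
  define n where "n = card I"
  define A :: "int mat" where "A = mat n n (\<lambda>(i, j). B (e i) (e j))"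
  define u where "u = vec n (\<lambda>i. v (e i))"
  have A: "A \<in> carrier_mat n n" by (simp add: A_def)
  obtain k where k: "k < n" "e k = i0"
    using e nz(1) unfolding n_def bij_betw_def by force
  have "u \<noteq> 0\<^sub>v n"
    using k nz(2) by (auto simp: u_def vec_eq_iff)
  moreover have "map_mat of_int A *\<^sub>v u = z \<cdot>\<^sub>v u"
  proof (rule eq_vecI)
    fix i assume "i < dim_vec (z \<cdot>\<^sub>v u)"
    then have i: "i < n" by (simp add: u_def)
    have "(map_mat of_int A *\<^sub>v u) $ i = (\<Sum>j\<in>{0..<n}. of_int (B (e i) (e j)) * v (e j))"
      using i by (simp add: A_def u_def scalar_prod_def)
    also have "\<dots> = (\<Sum>j\<in>I. of_int (B (e i) j) * v j)"
      by (rule sum.reindex_bij_betw) (use e n_def in simp)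
    also have "\<dots> = z * v (e i)"
      using eq[OF bij_betwE[OF e, rule_format, of i]] i by (simp add: n_def)
    finally show "(map_mat of_int A *\<^sub>v u) $ i = (z \<cdot>\<^sub>v u) $ i"
      using i by (simp add: u_def)
  qed (simp add: A_def u_def)
  ultimately have "eigenvalue (map_mat of_int A) z"
    unfolding eigenvalue_def eigenvector_def using A by (intro exI[of _ u]) (auto simp: u_def)
  then have "poly (char_poly (map_mat of_int A)) z = 0"
    using eigenvalue_root_char_poly[of "map_mat of_int A" n z] A by simp
  then have "poly (map_poly of_int (char_poly A)) z = 0"
    using of_int_hom.char_poly_hom[OF A, where ?'a = complex] by simp
  moreover have "lead_coeff (char_poly A) = 1"
    using degree_monic_char_poly[OF A] by simp
  ultimately show ?thesis
    unfolding algebraic_int_altdef_ipoly by blast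
qed

text \<open>The monic equation rewrites \<open>x ^ m\<close>, so the powers below \<open>m\<close>
  span \<int>[x]. The bound \<open>m > 0\<close> keeps \<open>x ^ 0 = 1\<close> among them, which
  later serves as the nonzero entry of an eigenvector.\<close>

lemma algebraic_int_power_reduce:
  fixes x :: complex
  assumes "algebraic_int x"
  obtains m where "m > 0" "\<And>i. \<exists>c :: nat \<Rightarrow> int. x ^ i = (\<Sum>k<m. of_int (c k) * x ^ k)"
proof -
  obtain f where f: "poly (map_poly of_int f) x = 0" "lead_coeff f = (1::int)"
    using assms unfolding algebraic_int_altdef_ipoly by blast
  define m where "m = degree f"
  have m: "m > 0"
  proof (rule ccontr)
    assume "\<not> m > 0"
    then obtain a where "f = [:a:]" using degree_eq_zeroE[of f] m_def by auto
    with f show False by auto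
  qed
  have deg: "degree (map_poly of_int f :: complex poly) = m"
    unfolding m_def by (simp add: degree_map_poly)
  have "0 = (\<Sum>i\<le>m. of_int (coeff f i) * x ^ i)"
    using f(1) unfolding poly_altdef deg by (simp add: coeff_map_poly)
  also have "\<dots> = (\<Sum>i<m. of_int (coeff f i) * x ^ i) + x ^ m"
    using f(2) unfolding lessThan_Suc_atMost[symmetric] by (simp add: m_def)
  finally have red: "x ^ m = (\<Sum>i<m. of_int (- coeff f i) * x ^ i)"
    by (simp add: sum_negf add_eq_0_iff)
  have "\<exists>c :: nat \<Rightarrow> int. x ^ i = (\<Sum>k<m. of_int (c k) * x ^ k)" for i
  proof (induction i)
    case 0
    have "x ^ 0 = (\<Sum>k<m. of_int (if k = 0 then 1 else 0) * x ^ k)"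
      using m by (subst sum.remove[of _ 0]) auto
    then show ?case by (intro exI[where x = "\<lambda>k. if k = 0 then 1 else 0"])
  next
    case (Suc i)
    then obtain c :: "nat \<Rightarrow> int" where c: "x ^ i = (\<Sum>k<m. of_int (c k) * x ^ k)" by blast
    obtain m' where m': "m = Suc m'" using m by (cases m) auto
    have "x ^ Suc i = (\<Sum>k<m. of_int (c k) * x ^ Suc k)"
      unfolding power_Suc c by (simp add: sum_distrib_left algebra_simps)
    also have "\<dots> = (\<Sum>k<m'. of_int (c k) * x ^ Suc k) + of_int (c m') * x ^ m"
      unfolding m' by simp
    also have "(\<Sum>k<m'. of_int (c k) * x ^ Suc k) = (\<Sum>k<m. of_int (if k = 0 then 0 else c (k - 1)) * x ^ k)"
      unfolding m' by (simp add: sum.lessThan_Suc_shift del: sum.lessThan_Suc)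
    also have "of_int (c m') * x ^ m = (\<Sum>k<m. of_int (- c m' * coeff f k) * x ^ k)"
      unfolding red by (simp add: sum_distrib_left mult.assoc sum_negf)
    finally have "x ^ Suc i = (\<Sum>k<m. of_int ((if k = 0 then 0 else c (k - 1)) + (- c m' * coeff f k)) * x ^ k)"
      by (simp only: sum.distrib[symmetric] of_int_add distrib_right)
    then show ?case
      by (intro exI[where x = "\<lambda>k. (if k = 0 then 0 else c (k - 1)) + (- c m' * coeff f k)"])
  qed
  with m show thesis using that by blast
qed

text \<open>The finitely many \<open>x ^ i * y ^ j\<close> span the module \<open>G\<close>, which
  is stable under multiplication by \<open>x\<close> and by \<open>y\<close>. Multiplication by
  \<open>x + y\<close> or \<open>x * y\<close> is therefore given by an integer matrix.\<close>

lemma algebraic_int_add_mult: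
  fixes x y :: complex
  assumes "algebraic_int x" "algebraic_int y"
  shows "algebraic_int (x + y)" "algebraic_int (x * y)"
proof -
  obtain m where m: "m > 0" "\<And>i. \<exists>c :: nat \<Rightarrow> int. x ^ i = (\<Sum>k<m. of_int (c k) * x ^ k)"
    using algebraic_int_power_reduce[OF assms(1)] by blast
  obtain n where n: "n > 0" "\<And>i. \<exists>c :: nat \<Rightarrow> int. y ^ i = (\<Sum>k<n. of_int (c k) * y ^ k)"
    using algebraic_int_power_reduce[OF assms(2)] by blast
  define I where "I = {..<m} \<times> {..<n}"
  define e where "e = (\<lambda>(i, j). x ^ i * y ^ j)"
  define G where "G = {w. \<exists>c :: nat \<times> nat \<Rightarrow> int. w = (\<Sum>k\<in>I. of_int (c k) * e k)}"
  have mono: "x ^ i * y ^ j \<in> G" for i j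
  proof -
    obtain c d :: "nat \<Rightarrow> int" where "x ^ i = (\<Sum>k<m. of_int (c k) * x ^ k)" "y ^ j = (\<Sum>k<n. of_int (d k) * y ^ k)"
      using m(2)[of i] n(2)[of j] by blast
    then have "x ^ i * y ^ j = (\<Sum>k\<in>I. of_int (case k of (a, b) \<Rightarrow> c a * d b) * e k)"
      by (simp only: sum_product sum.cartesian_product I_def e_def)
        (auto intro!: sum.cong simp: algebra_simps)
    then show ?thesis unfolding G_def by (intro CollectI exI)
  qed
  have add: "a + b \<in> G" if ab: "a \<in> G" "b \<in> G" for a b
  proof -
    obtain c d :: "nat \<times> nat \<Rightarrow> int" where "a = (\<Sum>k\<in>I. of_int (c k) * e k)" "b = (\<Sum>k\<in>I. of_int (d k) * e k)"
      using ab unfolding G_def by blast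
    then have "a + b = (\<Sum>k\<in>I. of_int (c k + d k) * e k)"
      by (simp add: sum.distrib algebra_simps)
    then show ?thesis unfolding G_def by (intro CollectI exI)
  qed
  have key: "algebraic_int z" if z: "\<And>i j. z * (x ^ i * y ^ j) \<in> G" for z
  proof -
    have "\<forall>k\<in>I. \<exists>c :: nat \<times> nat \<Rightarrow> int. z * e k = (\<Sum>l\<in>I. of_int (c l) * e l)"
      using z unfolding G_def e_def by auto
    then obtain B :: "nat \<times> nat \<Rightarrow> nat \<times> nat \<Rightarrow> int"
      where "\<And>k. k \<in> I \<Longrightarrow> z * e k = (\<Sum>l\<in>I. of_int (B k l) * e l)"
      by metis
    then show ?thesis
      using algebraic_int_eigenvalue[of I "(0, 0)" e z B] m(1) n(1) by (auto simp: I_def e_def)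
  qed
  show "algebraic_int (x + y)"
  proof (rule key)
    fix i j
    have "(x + y) * (x ^ i * y ^ j) = x ^ Suc i * y ^ j + x ^ i * y ^ Suc j"
      by (simp add: algebra_simps)
    then show "(x + y) * (x ^ i * y ^ j) \<in> G" using add mono by metis
  qed
  show "algebraic_int (x * y)"
  proof (rule key)
    fix i j
    have "(x * y) * (x ^ i * y ^ j) = x ^ Suc i * y ^ Suc j"
      by (simp add: algebra_simps)
    then show "(x * y) * (x ^ i * y ^ j) \<in> G" using mono by metis
  qed
qed

text \<open>A type of its own makes \<open>dvd\<close> mean divisibility among algebraic integers;
  over the field \<open>complex\<close> divisibility carries no information.\<close>

typedef alg_int = "{x :: complex. algebraic_int x}"
  morphisms complex_of_alg Abs_alg_int
  using algebraic_int_0 by blast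

setup_lifting type_definition_alg_int

instantiation alg_int :: idom
begin

lift_definition zero_alg_int :: alg_int is 0 by simp
lift_definition one_alg_int :: alg_int is 1 by simp
lift_definition plus_alg_int :: "alg_int \<Rightarrow> alg_int \<Rightarrow> alg_int" is "(+)"
  by (rule algebraic_int_add_mult)
lift_definition times_alg_int :: "alg_int \<Rightarrow> alg_int \<Rightarrow> alg_int" is "(*)"
  by (rule algebraic_int_add_mult)
lift_definition uminus_alg_int :: "alg_int \<Rightarrow> alg_int" is uminus
  by auto
lift_definition minus_alg_int :: "alg_int \<Rightarrow> alg_int \<Rightarrow> alg_int" is "(-)"
  by (metis algebraic_int_add_mult(1) algebraic_int_minus add_uminus_conv_diff)

instance
  by standard (transfer; simp add: algebra_simps)+

end

interpretation complex_of_alg: inj_idom_hom complex_of_alg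
  by standard (transfer; simp)+

lemma alg_int_rational:
  assumes "of_int k * x = (of_int r :: alg_int)" "k \<noteq> 0"
  shows "\<exists>n. x = of_int n"
proof -
  define z where "z = complex_of_alg x"
  have "of_int k * z = of_int r"
    using arg_cong[OF assms(1), of complex_of_alg] by (simp add: z_def hom_distribs)
  then have "z = of_int r / of_int k" using assms(2) by (simp add: field_simps)
  then have "z \<in> \<rat>" by simp
  moreover have "algebraic_int z" unfolding z_def using complex_of_alg by simp
  ultimately have "z \<in> \<int>" by (rule rational_algebraic_int_is_int[rotated])
  then obtain n where "z = of_int n" by (auto elim: Ints_cases)
  then have "complex_of_alg x = complex_of_alg (of_int n)" by (simp add: z_def hom_distribs)
  then show ?thesis by (auto simp: complex_of_alg_inject)
qed

instance alg_int :: ring_char_0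
proof
  show "inj (of_nat :: nat \<Rightarrow> alg_int)"
  proof (rule injI)
    fix a b assume "of_nat a = (of_nat b :: alg_int)"
    then have "complex_of_alg (of_nat a) = complex_of_alg (of_nat b)" by simp
    then show "a = b" by (simp add: hom_distribs)
  qed
qed

text \<open>Brings divisibility by powers of \<open>p\<close> back to the integers, where size
  decides. The quotient is rational and an algebraic integer, so it is an integer.\<close>

lemma of_int_dvd_of_int_alg_int_iff:
  "(of_int a :: alg_int) dvd of_int b \<longleftrightarrow> a dvd b"
proof
  assume "(of_int a :: alg_int) dvd of_int b"
  then obtain x where x: "of_int b = of_int a * (x :: alg_int)" by (elim dvdE)
  show "a dvd b"
  proof (cases "a = 0")
    case True
    with x show ?thesis by simp
  next
    case False
    then obtain n where "x = of_int n" using alg_int_rational[OF x[symmetric]] by blast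
    with x have "(of_int b :: alg_int) = of_int (a * n)" by simp
    then show ?thesis unfolding of_int_eq_iff by simp
  qed
qed (auto simp: dvd_def)

text \<open>Cancelling powers of \<open>x\<close> from an integer equation for \<open>x\<close>
  leaves a nonzero constant term, which is a multiple of \<open>x\<close>.\<close>

lemma alg_int_dvd_int:
  fixes x :: alg_int
  assumes "x \<noteq> 0"
  obtains c :: int where "c \<noteq> 0" "x dvd of_int c"
proof -
  define z where "z = complex_of_alg x"
  have z0: "z \<noteq> 0" using assms by (simp add: z_def)
  have "algebraic_int z" unfolding z_def using complex_of_alg by simp
  then obtain f where f: "poly (map_poly of_int f) z = 0" "lead_coeff f = (1::int)"
    unfolding algebraic_int_altdef_ipoly by blast
  have fx: "poly (map_poly of_int f) x = 0"
  proof -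
    have "complex_of_alg (poly (map_poly of_int f) x) = poly (map_poly complex_of_alg (map_poly of_int f)) z"
      by (simp add: z_def complex_of_alg.poly_map_poly)
    also have "map_poly complex_of_alg (map_poly of_int f) = map_poly of_int f"
      by (simp add: map_poly_map_poly o_def hom_distribs)
    finally show ?thesis using f by simp
  qed
  have "\<exists>c :: int. c \<noteq> 0 \<and> x dvd of_int c" if "poly (map_poly of_int f) x = 0" "f \<noteq> 0" for f :: "int poly"
    using that
  proof (induction f)
    case (pCons a g)
    show ?case
    proof (cases "a = 0")
      case True
      with pCons have "g \<noteq> 0" by auto
      moreover have "poly (map_poly of_int g) x = 0"
        using pCons.prems True assms by (simp add: map_poly_pCons)
      ultimately show ?thesis using pCons.IH by blast
    next
      case False
      have "of_int a + x * poly (map_poly of_int g) x = 0"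
        using pCons.prems by (simp add: map_poly_pCons)
      then have "of_int a = x * (- poly (map_poly of_int g) x)"
        by (simp add: add_eq_0_iff2)
      then have "x dvd of_int a" by simp
      with False show ?thesis by blast
    qed
  qed simp
  with fx f(2) that show thesis by (metis zero_neq_one leading_coeff_0_iff)
qed

section \<open>Primitive roots of unity\<close>

text \<open>Says that \<open>z\<close> has exact order \<open>N\<close>; \<open>N = 0\<close> would
  mean infinite order. The sort \<open>monoid_mult\<close> covers both \<open>complex\<close> and
  \<open>alg_int\<close>.\<close>

definition primitive_root_unity :: "nat \<Rightarrow> 'a :: monoid_mult \<Rightarrow> bool" where
  "primitive_root_unity N z \<longleftrightarrow> (\<forall>k. z ^ k = 1 \<longleftrightarrow> N dvd k)"

lemma primitive_root_unityD: "primitive_root_unity N z \<Longrightarrow> z ^ k = 1 \<longleftrightarrow> N dvd k"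
  by (simp add: primitive_root_unity_def)

lemma primitive_root_unity_power_eq_iff:
  fixes z :: "'a :: idom"
  assumes z: "primitive_root_unity N z" and "N > 0"
  shows "z ^ a = z ^ b \<longleftrightarrow> [a = b] (mod N)"
proof -
  have *: "z ^ a = z ^ b \<longleftrightarrow> [a = b] (mod N)" if "a \<le> b" for a b
  proof -
    have "z ^ N = 1" using primitive_root_unityD[OF z] by simp
    with \<open>N > 0\<close> have "z \<noteq> 0" by (metis power_eq_0_iff zero_neq_one power_0_left gr_implies_not0)
    then have "z ^ a = z ^ b \<longleftrightarrow> z ^ (b - a) = 1"
      using that by (metis le_add_diff_inverse mult_cancel_left2 power_add power_not_zero)
    also have "\<dots> \<longleftrightarrow> N dvd (b - a)" by (rule primitive_root_unityD[OF z])
    also have "\<dots> \<longleftrightarrow> [a = b] (mod N)"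
      using that by (metis cong_altdef_nat cong_sym_eq)
    finally show ?thesis .
  qed
  show ?thesis
    using *[of a b] *[of b a] by (metis cong_sym_eq nle_le)
qed

lemma primitive_root_unity_power:
  assumes z: "primitive_root_unity (d * m) z" and "m > 0"
  shows "primitive_root_unity d (z ^ m)"
  using assms by (simp add: primitive_root_unity_def mult.commute flip: power_mult)

lemma primitive_root_unity_coprime_power:
  assumes z: "primitive_root_unity N z" and "coprime a N"
  shows "primitive_root_unity N (z ^ a)"
  using assms by (simp add: primitive_root_unity_def coprime_commute coprime_dvd_mult_right_iff flip: power_mult)

text \<open>The \<open>N\<close> powers of \<open>z\<close> are distinct roots of X^N - 1, which has
  at most \<open>N\<close> roots in a domain.\<close>

lemma roots_unity_eq_powers:
  fixes z :: "'a :: idom"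
  assumes z: "primitive_root_unity N z" and "N > 0"
  shows "inj_on (\<lambda>a. z ^ a) {..<N}" "{x. x ^ N = 1} = (\<lambda>a. z ^ a) ` {..<N}"
proof -
  show inj: "inj_on (\<lambda>a. z ^ a) {..<N}"
    using primitive_root_unity_power_eq_iff[OF assms] by (auto simp: inj_on_def cong_def)
  define f :: "'a poly" where "f = monom 1 N - 1"
  have f0: "f \<noteq> 0"
  proof
    assume "f = 0"
    then have "coeff f N = 0" by simp
    with \<open>N > 0\<close> show False by (simp add: f_def)
  qed
  have "degree f \<le> N"
    unfolding f_def by (rule degree_diff_le) (simp_all add: degree_monom_le)
  moreover have roots: "{x. poly f x = 0} = {x. x ^ N = 1}"
    by (simp add: f_def poly_monom)
  ultimately have fin: "finite {x :: 'a. x ^ N = 1}" and card: "card {x :: 'a. x ^ N = 1} \<le> N"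
    using poly_roots_finite[OF f0] card_poly_roots_bound[OF f0] by auto
  have "(\<lambda>a. z ^ a) ` {..<N} \<subseteq> {x. x ^ N = 1}"
    using primitive_root_unityD[OF z] by (auto simp flip: power_mult)
  moreover have "card ((\<lambda>a. z ^ a) ` {..<N}) = N"
    using card_image[OF inj] by simp
  ultimately show "{x. x ^ N = 1} = (\<lambda>a. z ^ a) ` {..<N}"
    using card_subset_eq[OF fin] card card_mono[OF fin] by (metis le_antisym)
qed

lemma finite_primitive_roots_unity:
  fixes z :: "'a :: idom"
  assumes z: "primitive_root_unity N z" and "N > 0"
  shows "finite {x :: 'a. primitive_root_unity N x}"
proof -
  have "{x. primitive_root_unity N x} \<subseteq> (\<lambda>a. z ^ a) ` {..<N}"
    using roots_unity_eq_powers(2)[OF assms] primitive_root_unityD[of N _ N] by auto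
  then show ?thesis by (rule finite_subset) simp
qed

lemma bij_betw_totatives_primitive_roots:
  fixes z :: "'a :: idom"
  assumes z: "primitive_root_unity N z" and "N > 0"
  shows "bij_betw (\<lambda>a. z ^ a) (totatives N) {x. primitive_root_unity N x}"
proof (rule bij_betw_imageI)
  show "inj_on (\<lambda>a. z ^ a) (totatives N)"
  proof (rule inj_onI)
    fix a b assume ab: "a \<in> totatives N" "b \<in> totatives N" and "z ^ a = z ^ b"
    then have "[a = b] (mod N)" using primitive_root_unity_power_eq_iff[OF assms] by simp
    with ab show "a = b" 
      by (cases "a = N"; cases "b = N") (auto simp: totatives_def cong_def)
  qed
  show "(\<lambda>a. z ^ a) ` totatives N = {x. primitive_root_unity N x}"
  proof (intro subset_antisym subsetI)
    fix x :: 'a assume "x \<in> (\<lambda>a. z ^ a) ` totatives N"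
    then show "x \<in> {x. primitive_root_unity N x}"
      using primitive_root_unity_coprime_power[OF z] by (auto simp: totatives_def)
  next
    fix x :: 'a assume x: "x \<in> {x. primitive_root_unity N x}"
    then have "x ^ N = 1" by (simp add: primitive_root_unity_def)
    then obtain a where a: "a < N" "x = z ^ a"
      using roots_unity_eq_powers(2)[OF assms] by blast
    \<comment> \<open>The order of \<open>z ^ a\<close> divides \<open>N div g\<close>; since it
      equals \<open>N\<close>, the gcd must be 1.\<close>
    define g where "g = gcd a N"
    have "N dvd a * (N div g)"
      by (simp add: g_def) (metis div_mult_swap dvd_triv_right gcd_dvd1 gcd_dvd2 mult.commute)
    then have "x ^ (N div g) = 1"
      using primitive_root_unityD[OF z] a by (simp flip: power_mult)
    then have "N dvd N div g" using x by (simp add: primitive_root_unity_def)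
    moreover have "N div g > 0" using \<open>N > 0\<close> by (simp add: g_def div_greater_zero_iff gcd_le2_nat)
    ultimately have "N \<le> N div g" by (rule dvd_imp_le)
    have "g > 0" using \<open>N > 0\<close> by (simp add: g_def)
    moreover have "\<not> 1 < g"
      using \<open>N \<le> N div g\<close> \<open>N > 0\<close> by (auto simp: not_less[symmetric])
    ultimately have "g = 1" by linarith
    then have cop: "coprime a N" by (simp add: g_def coprime_iff_gcd_eq_1)
    show "x \<in> (\<lambda>a. z ^ a) ` totatives N"
    \<comment> \<open>\<open>totatives N\<close> lies in 1..N while \<open>a\<close> ranges over
      0..N-1. The exponent 0 is coprime to \<open>N\<close> only for \<open>N = 1\<close>, and is
      then replaced by 1.\<close>
    proof (cases "a = 0")
      case True
      with cop have "N = 1" by simp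
      with True a have "x = z ^ 1" "1 \<in> totatives N"
        using primitive_root_unityD[OF z, of 1] by auto
      then show ?thesis by blast
    next
      case False
      with cop a show ?thesis by (auto simp: totatives_def)
    qed
  qed
qed

lemma card_primitive_roots_unity:
  fixes z :: "'a :: idom"
  assumes "primitive_root_unity N z" "N > 0"
  shows "card {x :: 'a. primitive_root_unity N x} = totient N"
  using bij_betw_same_card[OF bij_betw_totatives_primitive_roots[OF assms]] by (simp add: totient_def)

lemma primitive_root_unity_exists_order:
  fixes x :: "'a :: idom"
  assumes "x ^ N = 1" "N > 0"
  obtains d where "d > 0" "d dvd N" "primitive_root_unity d x"
proof -
  define d where "d = (LEAST k. k > 0 \<and> x ^ k = 1)"
  have d: "d > 0" "x ^ d = 1"
    using LeastI[of "\<lambda>k. k > 0 \<and> x ^ k = 1" N] assms by (auto simp: d_def)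
  have "x ^ k = 1 \<longleftrightarrow> d dvd k" for k
  proof
    assume "x ^ k = 1"
    moreover have "x ^ k = (x ^ d) ^ (k div d) * x ^ (k mod d)"
      by (metis mult_div_mod_eq power_add power_mult)
    ultimately have "x ^ (k mod d) = 1" using d by simp
    moreover have "k mod d < d" using d by simp
    ultimately have "k mod d = 0"
      using not_less_Least[of "k mod d" "\<lambda>k. k > 0 \<and> x ^ k = 1"] unfolding d_def[symmetric] by auto
    then show "d dvd k" by auto
  qed (use d in \<open>auto simp: power_mult\<close>)
  then have "primitive_root_unity d x" by (simp add: primitive_root_unity_def)
  with d that assms show thesis by (simp add: primitive_root_unity_def)
qed

text \<open>Split the \<open>N\<close>-th roots of unity by exact order. The full sum is geometric,
  with value \<open>N\<close> or 0, and the orders properly dividing \<open>N\<close> are covered by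
  induction.\<close>

lemma ramanujan_sum_int:
  fixes z :: "'a :: idom"
  assumes "primitive_root_unity N z" "N > 0"
  shows "\<exists>r :: int. (\<Sum>x | primitive_root_unity N x. x ^ i) = (of_int r :: 'a)"
  using assms
proof (induction N arbitrary: z rule: less_induct)
  case (less N)
  note z = less.prems
  let ?P = "\<lambda>d. {x :: 'a. primitive_root_unity d x}"
  have prim: "\<exists>y :: 'a. primitive_root_unity d y" if "d dvd N" for d
  proof -
    from that obtain m where "N = d * m" by blast
    with z primitive_root_unity_power[of d m z] show ?thesis by auto
  qed
  have fin: "finite (?P d)" if "d dvd N" for d
    using prim[OF that] finite_primitive_roots_unity that \<open>N > 0\<close> by (metis dvd_pos_nat)
  have decomp: "{x :: 'a. x ^ N = 1} = (\<Union>d\<in>{d. d dvd N}. ?P d)"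
  proof (intro subset_antisym subsetI)
    fix x :: 'a assume "x \<in> {x. x ^ N = 1}"
    then obtain d where "d dvd N" "primitive_root_unity d x"
      using primitive_root_unity_exists_order[of x N] \<open>N > 0\<close> by auto
    then show "x \<in> (\<Union>d\<in>{d. d dvd N}. ?P d)" by blast
  qed (auto simp: primitive_root_unity_def)
  have disj: "?P d \<inter> ?P e = {}" if "d \<noteq> e" for d e
    using that by (auto simp: primitive_root_unity_def) (meson dvd_antisym dvd_refl)
  have "(\<Sum>x | x ^ N = 1. x ^ i) = (\<Sum>d | d dvd N. \<Sum>x\<in>?P d. x ^ i)"
    unfolding decomp using fin \<open>N > 0\<close> disj by (intro sum.UNION_disjoint) auto
  also have "\<dots> = (\<Sum>x\<in>?P N. x ^ i) + (\<Sum>d\<in>{d. d dvd N} - {N}. \<Sum>x\<in>?P d. x ^ i)"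
    using \<open>N > 0\<close> by (intro sum.remove) auto
  finally have eq: "(\<Sum>x\<in>?P N. x ^ i) = (\<Sum>x | x ^ N = 1. x ^ i) - (\<Sum>d\<in>{d. d dvd N} - {N}. \<Sum>x\<in>?P d. x ^ i)"
    by simp
  have "\<exists>r :: int. (\<Sum>x\<in>?P d. x ^ i) = of_int r" if "d \<in> {d. d dvd N} - {N}" for d
  proof -
    have d: "d dvd N" "d \<noteq> N" using that by auto
    then have "d < N" "d > 0" using \<open>N > 0\<close> by (auto simp: dvd_imp_le le_neq_implies_less intro: dvd_pos_nat)
    then show ?thesis using less.IH prim[OF d(1)] by blast
  qed
  then obtain r :: "nat \<Rightarrow> int" where r: "\<And>d. d \<in> {d. d dvd N} - {N} \<Longrightarrow> (\<Sum>x\<in>?P d. x ^ i) = of_int (r d)"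
    by metis
  then have 1: "(\<Sum>d\<in>{d. d dvd N} - {N}. \<Sum>x\<in>?P d. x ^ i) = of_int (\<Sum>d\<in>{d. d dvd N} - {N}. r d)"
    by simp
  have "(\<Sum>x | x ^ N = 1. x ^ i) = (\<Sum>a<N. (z ^ i) ^ a)"
    unfolding roots_unity_eq_powers(2)[OF z] sum.reindex[OF roots_unity_eq_powers(1)[OF z]]
    by (simp add: o_def mult.commute flip: power_mult)
  also have "\<exists>s :: int. \<dots> = of_int s"
  proof (cases "z ^ i = 1")
    case True
    then have "(\<Sum>a<N. (z ^ i) ^ a) = of_int (int N)" by simp
    then show ?thesis by blast
  next
    case False
    have "(1 - z ^ i) * (\<Sum>a<N. (z ^ i) ^ a) = 1 - (z ^ i) ^ N"
      by (rule one_diff_power_eq[symmetric])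
    also have "\<dots> = 0"
      using primitive_root_unityD[OF z(1), of "i * N"] by (simp add: power_mult)
    finally have "(\<Sum>a<N. (z ^ i) ^ a) = of_int 0" using False by simp
    then show ?thesis by blast
  qed
  finally obtain s :: int where 2: "(\<Sum>x | x ^ N = 1. x ^ i) = (of_int s :: 'a)" by blast
  show ?case
    unfolding eq 1 2 by (metis of_int_diff)
qed

text \<open>The product plays the role of the norm from the cyclotomic field to the rationals,
  without Galois theory.\<close>

lemma prod_primitive_roots_poly_int:
  fixes f :: "int poly" and z :: alg_int
  assumes z: "primitive_root_unity N z" and "N > 0"
  shows "\<exists>n :: int. (\<Prod>x | primitive_root_unity N x. poly (map_poly of_int f) x) = (of_int n :: alg_int)"
proof -
  let ?P = "{x :: alg_int. primitive_root_unity N x}"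
  define n where "n = (\<Prod>x\<in>?P. poly (map_poly of_int f) x)"
  \<comment> \<open>\<open>F\<close> takes the value \<open>n\<close> at every primitive root; averaging over them writes
    \<open>totient N * n\<close> as an integer combination of Ramanujan sums, so \<open>n\<close> is rational.\<close>
  define F where "F = (\<Prod>a\<in>totatives N. f \<circ>\<^sub>p monom 1 a)"
  have F: "poly (map_poly of_int F) y = n" if "y \<in> ?P" for y
  proof -
    have "poly (map_poly of_int F) y = (\<Prod>a\<in>totatives N. poly (map_poly of_int f) (y ^ a))"
      by (simp add: F_def hom_distribs poly_prod poly_pcompose poly_monom of_int_hom.map_poly_pcompose)
    also have "\<dots> = n"
      unfolding n_def using that \<open>N > 0\<close>
      by (intro prod.reindex_bij_betw bij_betw_totatives_primitive_roots) auto
    finally show ?thesis .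
  qed
  obtain r :: "nat \<Rightarrow> int" where r: "\<And>i. (\<Sum>x\<in>?P. x ^ i) = of_int (r i)"
    using ramanujan_sum_int[OF assms] by metis
  have "of_int (int (totient N)) * n = (\<Sum>x\<in>?P. n)"
    using card_primitive_roots_unity[OF assms] by simp
  also have "\<dots> = (\<Sum>x\<in>?P. poly (map_poly of_int F) x)"
    using F by simp
  also have "\<dots> = (\<Sum>x\<in>?P. \<Sum>i\<le>degree F. of_int (coeff F i) * x ^ i)"
    by (simp add: poly_altdef)
  also have "\<dots> = (\<Sum>i\<le>degree F. of_int (coeff F i) * (\<Sum>x\<in>?P. x ^ i))"
    by (subst sum.swap) (simp add: sum_distrib_left)
  also have "\<dots> = of_int (\<Sum>i\<le>degree F. coeff F i * r i)"
    by (simp add: r)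
  finally have "of_int (int (totient N)) * n = of_int (\<Sum>i\<le>degree F. coeff F i * r i)" .
  moreover have "int (totient N) \<noteq> 0" using \<open>N > 0\<close> by simp
  ultimately show ?thesis unfolding n_def by (rule alg_int_rational)
qed

section \<open>Minors and Hadamard's inequality\<close>

text \<open>Enumerating \<open>S\<close> by \<open>pick\<close> agrees with
  \<open>submatrix\<close>, while entries given by a function allow the same minor to be formed over
  integer polynomials, \<open>alg_int\<close> and \<open>complex\<close>.\<close>

definition family_mat :: "(nat \<Rightarrow> nat \<Rightarrow> 'a) \<Rightarrow> nat set \<Rightarrow> 'a mat" where
  "family_mat f S = mat (card S) (card S) (\<lambda>(i, j). f (pick S i) (pick S j))"

lemma family_mat_carrier [simp]: "family_mat f S \<in> carrier_mat (card S) (card S)"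
  by (simp add: family_mat_def)

lemma bij_betw_pick:
  assumes "finite S"
  shows "bij_betw (pick S) {0..<card S} S"
proof (rule bij_betw_imageI)
  show "inj_on (pick S) {0..<card S}"
    using pick_mono_le by (auto simp: inj_on_def) (metis less_irrefl linorder_neqE_nat)
  then have "card (pick S ` {0..<card S}) = card S" by (simp add: card_image)
  then show "pick S ` {0..<card S} = S"
    using assms pick_in_set_le by (intro card_subset_eq) auto
qed

lemma (in comm_ring_hom) hom_det_family_mat:
  "hom (det (family_mat f S)) = det (family_mat (\<lambda>x y. hom (f x y)) S)"
proof -
  have "map_mat hom (family_mat f S) = family_mat (\<lambda>x y. hom (f x y)) S"
    by (rule eq_matI) (auto simp: family_mat_def)
  then show ?thesis by (metis hom_det)
qed

text \<open>The kernel vector is found over the domain itself, so over \<open>alg_int\<close> its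
  entries are algebraic integers and can be tested for divisibility.\<close>

lemma det_family_mat_0_imp_kernel:
  fixes f :: "nat \<Rightarrow> nat \<Rightarrow> 'a :: idom"
  assumes S: "finite S" and det: "det (family_mat f S) = 0"
  obtains v where "\<exists>x\<in>S. v x \<noteq> 0" "\<And>x. x \<in> S \<Longrightarrow> (\<Sum>y\<in>S. f x y * v y) = 0"
proof -
  let ?n = "card S"
  obtain u where u: "u \<in> carrier_vec ?n" "u \<noteq> 0\<^sub>v ?n" "family_mat f S *\<^sub>v u = 0\<^sub>v ?n"
    using det det_0_iff_vec_prod_zero[OF family_mat_carrier, of f S] by auto
  define r where "r = inv_into {0..<?n} (pick S)"
  have r: "r (pick S i) = i" if "i < ?n" for i
    unfolding r_def by (rule inv_into_f_f) (use bij_betw_pick[OF S] that in \<open>auto simp: bij_betw_def\<close>)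
  have surj: "\<exists>i<?n. x = pick S i" if "x \<in> S" for x
    using bij_betw_pick[OF S] that unfolding bij_betw_def by force
  show thesis
  proof
    obtain i where i: "i < ?n" "u $ i \<noteq> 0"
      using u(1,2) by (auto simp: vec_eq_iff)
    then show "\<exists>x\<in>S. u $ r x \<noteq> 0"
      using r pick_in_set_le by (intro bexI[of _ "pick S i"]) auto
  next
    fix x assume "x \<in> S"
    then obtain i where i: "i < ?n" "x = pick S i" using surj by blast
    have "(\<Sum>y\<in>S. f x y * u $ r y) = (\<Sum>j\<in>{0..<?n}. f x (pick S j) * u $ r (pick S j))"
      by (rule sum.reindex_bij_betw[symmetric]) (rule bij_betw_pick[OF S])
    also have "\<dots> = (family_mat f S *\<^sub>v u) $ i"
      using i u(1) r by (auto simp: family_mat_def scalar_prod_def intro!: sum.cong)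
    finally show "(\<Sum>y\<in>S. f x y * u $ r y) = 0" using u(3) i by simp
  qed
qed

text \<open>Cramer's rule modulo \<open>c\<close>: applying the adjugate to the system leaves the
  determinant times each unknown.\<close>

lemma det_family_mat_mult_dvd:
  fixes f :: "nat \<Rightarrow> nat \<Rightarrow> 'a :: comm_ring_1"
  assumes S: "finite S" and dvd: "\<And>x. x \<in> S \<Longrightarrow> c dvd (\<Sum>y\<in>S. f x y * w y)" and x: "x \<in> S"
  shows "c dvd det (family_mat f S) * w x"
proof -
  let ?n = "card S"
  let ?A = "family_mat f S"
  define u where "u = vec ?n (\<lambda>i. w (pick S i))"
  note adj = adj_mat[OF family_mat_carrier, of f S]
  obtain k where k: "k < ?n" "x = pick S k"
    using bij_betw_pick[OF S] x unfolding bij_betw_def by force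
  have Au: "c dvd (?A *\<^sub>v u) $ i" if "i < ?n" for i
  proof -
    have "(?A *\<^sub>v u) $ i = (\<Sum>j\<in>{0..<?n}. f (pick S i) (pick S j) * w (pick S j))"
      using that by (simp add: family_mat_def u_def scalar_prod_def)
    also have "\<dots> = (\<Sum>y\<in>S. f (pick S i) y * w y)"
      by (rule sum.reindex_bij_betw) (rule bij_betw_pick[OF S])
    finally show ?thesis using dvd pick_in_set_le[OF that] by simp
  qed
  have "c dvd (adj_mat ?A *\<^sub>v (?A *\<^sub>v u)) $ k"
  proof -
    have "(adj_mat ?A *\<^sub>v (?A *\<^sub>v u)) $ k = (\<Sum>i\<in>{0..<?n}. adj_mat ?A $$ (k, i) * (?A *\<^sub>v u) $ i)"
      using k adj(1) by (subst index_mult_mat_vec) (auto simp: scalar_prod_def family_mat_def)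
    then show ?thesis using Au by (auto intro!: dvd_sum)
  qed
  also have "adj_mat ?A *\<^sub>v (?A *\<^sub>v u) = (adj_mat ?A * ?A) *\<^sub>v u"
    by (rule assoc_mult_mat_vec[symmetric, OF adj(1) family_mat_carrier]) (simp add: u_def)
  also have "\<dots> $ k = det ?A * w x"
    using k unfolding adj(3) by (simp add: u_def scalar_prod_def if_distrib[of "\<lambda>a. _ * a * _"] cong: if_cong)
  finally show ?thesis .
qed

section \<open>Trace, eigenvalues and Hadamard's inequality\<close>

definition mat_trace :: "'a :: comm_ring_1 mat \<Rightarrow> 'a" where
  "mat_trace A = (\<Sum>i<dim_row A. A $$ (i, i))"

lemma mat_trace_comm:
  assumes "A \<in> carrier_mat n n" "B \<in> carrier_mat n n"
  shows "mat_trace (A * B) = mat_trace (B * A)"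
proof -
  have "mat_trace (A * B) = (\<Sum>i<n. \<Sum>j<n. A $$ (i, j) * B $$ (j, i))"
    using assms by (auto simp: mat_trace_def scalar_prod_def atLeast0LessThan intro!: sum.cong)
  also have "\<dots> = (\<Sum>j<n. \<Sum>i<n. B $$ (j, i) * A $$ (i, j))"
    by (subst sum.swap) (simp add: mult.commute)
  also have "\<dots> = mat_trace (B * A)"
    using assms by (auto simp: mat_trace_def scalar_prod_def atLeast0LessThan intro!: sum.cong)
  finally show ?thesis .
qed

text \<open>Determinant and trace are invariant under similarity and can be read off the diagonal of
  a Schur triangular form.\<close>

lemma complex_mat_eigenvalue_list:
  fixes A :: "complex mat"
  assumes A: "A \<in> carrier_mat n n"
  obtains es where "length es = n" "det A = prod_list es" "mat_trace A = sum_list es"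
    "\<And>e. e \<in> set es \<Longrightarrow> eigenvalue A e"
proof -
  obtain es where es: "char_poly A = (\<Prod>e\<leftarrow>es. [:- e, 1:])" "length es = n"
    using char_poly_factorized[OF A] by blast
  obtain B P Q where BPQ: "schur_decomposition A es = (B, P, Q)"
    by (cases "schur_decomposition A es") auto
  have B: "similar_mat_wit A B P Q" "upper_triangular B" "diag_mat B = es"
    using schur_decomposition[OF A es(1) BPQ] by auto
  note wit = similar_mat_witD2[OF A B(1)]
  have Bc: "B \<in> carrier_mat n n" using wit by simp
  have "det A = det B"
    by (rule det_similar) (use B(1) in \<open>auto simp: similar_mat_def\<close>)
  also have "\<dots> = prod_list es"
    using det_upper_triangular[OF B(2) Bc] B(3) by simp
  finally have det: "det A = prod_list es" .
  have "mat_trace A = mat_trace (P * (B * Q))"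
    using wit by (simp add: assoc_mult_mat[of P n n B n Q n])
  also have "\<dots> = mat_trace ((B * Q) * P)"
    using wit by (intro mat_trace_comm[of _ n]) auto
  also have "(B * Q) * P = B"
    using wit by (simp add: assoc_mult_mat[of B n n Q n P n])
  also have "mat_trace B = sum_list es"
    using B(3) by (auto simp: mat_trace_def diag_mat_def sum_list_sum_nth atLeast0LessThan)
  finally have tr: "mat_trace A = sum_list es" .
  have "eigenvalue A e" if "e \<in> set es" for e
    unfolding eigenvalue_root_char_poly[OF A] es(1)
    using that by (auto simp: poly_prod_list prod_list_zero_iff)
  with es det tr that show thesis by blast
qed

text \<open>For an eigenvector \<open>v\<close> and \<open>w = H *\<^sub>v v\<close>, adjointness
  gives e |v|^2 = |w|^2, so \<open>e\<close> is a quotient of nonnegative reals.\<close>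

lemma eigenvalue_mult_adjoint_nonneg:
  fixes A :: "complex mat"
  assumes A: "A \<in> carrier_mat n n" 
  defines "H \<equiv> mat n n (\<lambda>(i, j). cnj (A $$ (j, i)))"
  assumes e: "eigenvalue (A * H) e"
  shows "e = of_real (norm e)"
proof -
  have H: "H \<in> carrier_mat n n" by (simp add: H_def)
  obtain v where v: "v \<in> carrier_vec n" "v \<noteq> 0\<^sub>v n" "(A * H) *\<^sub>v v = e \<cdot>\<^sub>v v"
    using e A H unfolding eigenvalue_def eigenvector_def by auto
  define w where "w = H *\<^sub>v v"
  have w: "w \<in> carrier_vec n" "A *\<^sub>v w = e \<cdot>\<^sub>v v"
    using v A H by (auto simp: w_def)
  have wj: "w $ j = (\<Sum>i<n. cnj (A $$ (i, j)) * v $ i)" if "j < n" for j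
    using that v(1) by (auto simp: w_def H_def scalar_prod_def atLeast0LessThan intro!: sum.cong)
  have cw: "cnj (w $ j) = (\<Sum>i<n. cnj (v $ i) * A $$ (i, j))" if "j < n" for j
    using that by (simp add: wj mult.commute)
  have Aw: "(\<Sum>j<n. A $$ (i, j) * w $ j) = e * v $ i" if "i < n" for i
  proof -
    have "(A *\<^sub>v w) $ i = (\<Sum>j<n. A $$ (i, j) * w $ j)"
      using that A w(1) by (auto simp: scalar_prod_def atLeast0LessThan intro!: sum.cong)
    then show ?thesis using w(2) that v(1) by simp
  qed
  define a b where "a = (\<Sum>i<n. (norm (v $ i))\<^sup>2)" and "b = (\<Sum>j<n. (norm (w $ j))\<^sup>2)"
  have "e * of_real a = (\<Sum>i<n. cnj (v $ i) * (e * v $ i))"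
    by (simp add: a_def sum_distrib_left complex_norm_square algebra_simps del: of_real_power)
  also have "\<dots> = (\<Sum>i<n. \<Sum>j<n. cnj (v $ i) * (A $$ (i, j) * w $ j))"
    by (simp add: Aw[symmetric] sum_distrib_left)
  also have "\<dots> = (\<Sum>j<n. \<Sum>i<n. cnj (v $ i) * (A $$ (i, j) * w $ j))"
    by (rule sum.swap)
  also have "\<dots> = (\<Sum>j<n. cnj (w $ j) * w $ j)"
    by (intro sum.cong refl) (simp add: cw sum_distrib_right mult.assoc)
  also have "\<dots> = of_real b"
    by (simp add: b_def complex_norm_square mult.commute del: of_real_power)
  finally have ab: "e * of_real a = of_real b" .
  obtain i where "i < n" "v $ i \<noteq> 0" using v(1,2) by (auto simp: vec_eq_iff)
  then have "a > 0" unfolding a_def by (intro sum_pos2[of _ i]) auto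
  moreover have "b \<ge> 0" unfolding b_def by (intro sum_nonneg) auto
  ultimately have "e = of_real (b / a)" "b / a \<ge> 0"
    using ab by (auto simp: field_simps)
  then show ?thesis by (metis abs_of_nonneg norm_of_real)
qed

text \<open>The eigenvalues of \<open>A * H\<close>, with \<open>H\<close> the conjugate transpose,
  are nonnegative. Their product is |det A|^2 and their sum is the sum of all |entry|^2, at most
  n^2, so the arithmetic-geometric mean inequality applies.\<close>

lemma hadamard_bound:
  fixes A :: "complex mat"
  assumes A: "A \<in> carrier_mat n n" and le: "\<And>i j. i < n \<Longrightarrow> j < n \<Longrightarrow> norm (A $$ (i, j)) \<le> 1"
  shows "(norm (det A))\<^sup>2 \<le> real n ^ n"
proof (cases "n = 0")
  case True
  then show ?thesis using A by (simp add: det_def)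
next
  case False
  define H where "H = mat n n (\<lambda>(i, j). cnj (A $$ (j, i)))"
  have H: "H \<in> carrier_mat n n" by (simp add: H_def)
  interpret cnj: comm_ring_hom cnj by standard auto
  have "H = map_mat cnj (transpose_mat A)"
    using A by (intro eq_matI) (auto simp: H_def)
  then have "det H = cnj (det A)"
    using det_transpose[OF A] by simp
  then have norm_det: "norm (det (A * H)) = (norm (det A))\<^sup>2"
    using det_mult[OF A H] by (simp add: norm_mult power2_eq_square)
  obtain es where es: "length es = n" "det (A * H) = prod_list es" "mat_trace (A * H) = sum_list es"
    "\<And>e. e \<in> set es \<Longrightarrow> eigenvalue (A * H) e"
    using complex_mat_eigenvalue_list[of "A * H" n] A H by auto
  have nonneg: "es ! i = of_real (norm (es ! i))" if "i < n" for i
    using eigenvalue_mult_adjoint_nonneg[OF A, of "es ! i"] es(1,4) that unfolding H_def by simp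
  have "complex_of_real (\<Sum>i<n. norm (es ! i)) = (\<Sum>i<n. es ! i)"
    unfolding of_real_sum using nonneg by (intro sum.cong) auto
  also have "\<dots> = mat_trace (A * H)"
    using es(1,3) by (simp add: sum_list_sum_nth atLeast0LessThan)
  also have "\<dots> = (\<Sum>i<n. \<Sum>j<n. A $$ (i, j) * cnj (A $$ (i, j)))"
    using A by (auto simp: mat_trace_def H_def scalar_prod_def atLeast0LessThan intro!: sum.cong)
  also have "\<dots> = complex_of_real (\<Sum>i<n. \<Sum>j<n. (norm (A $$ (i, j)))\<^sup>2)"
    by (simp add: complex_norm_square del: of_real_power)
  finally have "(\<Sum>i<n. norm (es ! i)) = (\<Sum>i<n. \<Sum>j<n. (norm (A $$ (i, j)))\<^sup>2)"
    unfolding of_real_eq_iff .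
  also have "\<dots> \<le> (\<Sum>i<n. \<Sum>j<n. 1)"
    using le by (intro sum_mono) (auto simp: power_le_one)
  finally have sum_le: "(\<Sum>i<n. norm (es ! i)) \<le> real n * real n" by simp
  have "(\<Prod>i<n. norm (es ! i)) powr (1 / real n) \<le> (\<Sum>i<n. norm (es ! i) / real n)"
    using arith_geom_mean[of "{..<n}" "\<lambda>i. norm (es ! i)"] False by auto
  also have "\<dots> \<le> real n"
    using sum_le False by (simp add: sum_divide_distrib[symmetric] field_simps)
  finally have "((\<Prod>i<n. norm (es ! i)) powr (1 / real n)) powr real n \<le> real n powr real n"
    by (intro powr_mono2) auto
  then have "(\<Prod>i<n. norm (es ! i)) \<le> real n ^ n"
    using False by (simp add: powr_powr powr_realpow prod_nonneg)
  moreover have "norm (det (A * H)) = (\<Prod>i<n. norm (es ! i))"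
    unfolding es(2) using es(1) by (simp add: prod.list_conv_set_nth prod_norm atLeast0LessThan)
  ultimately show ?thesis using norm_det by simp
qed

section \<open>Kernel vectors modulo a prime\<close>

text \<open>By Bezout, an integer prime to \<open>p\<close> is a unit modulo every divisor
  \<open>c\<close> of \<open>p\<close>.\<close>

lemma dvd_cancel_of_int:
  fixes c w :: "'a :: comm_ring_1"
  assumes "prime p" "c dvd of_nat p" "\<not> int p dvd n" "c dvd of_int n * w"
  shows "c dvd w"
proof -
  have "coprime n (int p)"
    using assms(1,3) by (metis coprime_commute prime_imp_coprime prime_nat_int_transfer)
  then obtain a b where ab: "a * n + b * int p = 1"
    by (metis coprime_iff_gcd_eq_1 bezout_int)
  have "w = of_int (a * n + b * int p) * w" unfolding ab by simp
  also have "\<dots> = of_int a * (of_int n * w) + of_int b * (of_nat p * w)"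
    by (simp add: algebra_simps)
  finally show ?thesis
    using assms(2,4) by (metis dvd_add dvd_mult dvd_mult2)
qed

text \<open>\<open>f\<close> is a multiple of the product of the X - r with \<open>r\<close> in
  \<open>R\<close>, and modulo \<open>c\<close> this product is X^(card R). The induction splits off
  one root at a time.\<close>

lemma dvd_coeff_of_roots:
  fixes f :: "'a :: idom poly"
  assumes "finite R" "\<And>r. r \<in> R \<Longrightarrow> poly f r = 0" "\<And>r. r \<in> R \<Longrightarrow> c dvd r" "l < card R"
  shows "c dvd coeff f l"
  using assms
proof (induction R arbitrary: f l rule: finite_induct)
  case (insert r R)
  have "poly f r = 0" using insert.prems by simp
  then obtain q where q: "f = [:- r, 1:] * q" using poly_eq_0_iff_dvd by (metis dvdE)
  have q0: "poly q s = 0" if "s \<in> R" for s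
  proof -
    have "(s - r) * poly q s = 0" using insert.prems(1)[of s] that unfolding q by (simp add: algebra_simps)
    moreover have "s \<noteq> r" using that insert.hyps by auto
    ultimately show ?thesis by simp
  qed
  have IH: "c dvd coeff q k" if "k < card R" for k
    using insert.IH[of q k] q0 insert.prems that by auto
  have "c dvd r" using insert.prems by simp
  have "coeff f l = - r * coeff q l + (case l of 0 \<Rightarrow> 0 | Suc k \<Rightarrow> coeff q k)"
    by (cases l) (simp_all add: q)
  moreover have "c dvd (case l of 0 \<Rightarrow> 0 | Suc k \<Rightarrow> coeff q k)"
    using insert by (cases l) (auto intro: IH)
  ultimately show ?case using \<open>c dvd r\<close> by simp
qed simp

lemma coeff_one_plus_X_power:
  "coeff ([:1, 1:] ^ n) l = (of_nat (n choose l) :: 'a :: comm_ring_1)"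
proof (cases "l \<le> n")
  case True
  then show ?thesis by (simp add: coeff_linear_poly_power)
next
  case False
  have "degree ([:1, 1 :: 'a:] ^ n) \<le> n"
    using degree_power_le[of "[:1, 1 :: 'a:]" n] by simp
  then have "coeff ([:1, 1 :: 'a:] ^ n) l = 0"
    using False by (intro coeff_eq_0) simp
  with False show ?thesis by (simp add: binomial_eq_0)
qed

text \<open>Multiplication by \<open>y\<close> in the basis of binomial coefficients raises the
  lower index by at most one, so each elimination costs a single equation.\<close>

lemma mult_binomial_eq:
  fixes y l :: nat
  shows "y * (y choose l) = Suc l * (y choose Suc l) + l * (y choose l)"
  using Suc_times_binomial[of l y] by (simp add: algebra_simps)

text \<open>
  A substitute for the Vandermonde determinant: multiplying the unknown \<open>v i\<close> by
  \<open>y i - y i0\<close> eliminates it for \<open>i = i0\<close> at the cost of one equation.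
\<close>
lemma binomial_system_dvd:
  fixes c :: "'a :: comm_ring_1" and y :: "'i \<Rightarrow> nat"
  assumes p: "prime p" "c dvd of_nat p"
    and I: "finite I" "inj_on y I" "\<And>i. i \<in> I \<Longrightarrow> y i < p"
    and dvd: "\<And>l. l < card I \<Longrightarrow> c dvd (\<Sum>i\<in>I. v i * of_nat (y i choose l))"
    and i: "i \<in> I"
  shows "c dvd v i"
  using I dvd i
proof (induction I arbitrary: v i rule: finite_induct)
  case (insert i0 I)
  let ?J = "insert i0 I"
  define s where "s = (\<lambda>l. \<Sum>i\<in>?J. v i * of_nat (y i choose l))"
  have s: "c dvd s l" if "l < card ?J" for l
    using insert.prems(3) that unfolding s_def by blast
  define v' where "v' = (\<lambda>i. of_int (int (y i) - int (y i0)) * v i)"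
  have sum': "(\<Sum>i\<in>I. v' i * of_nat (y i choose l))
      = of_nat (Suc l) * s (Suc l) + of_nat l * s l - of_nat (y i0) * s l" for l
  proof -
    have "(\<Sum>i\<in>I. v' i * of_nat (y i choose l)) = (\<Sum>i\<in>?J. v' i * of_nat (y i choose l))"
      using insert.hyps by (simp add: v'_def)
    also have "\<dots> = (\<Sum>i\<in>?J. v i * of_nat (y i * (y i choose l)) - of_nat (y i0) * (v i * of_nat (y i choose l)))"
      by (simp add: v'_def algebra_simps)
    also have "\<dots> = (\<Sum>i\<in>?J. of_nat (Suc l) * (v i * of_nat (y i choose Suc l))
        + of_nat l * (v i * of_nat (y i choose l)) - of_nat (y i0) * (v i * of_nat (y i choose l)))"
      unfolding mult_binomial_eq by (simp only: of_nat_add of_nat_mult distrib_left mult.left_commute)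
    also have "\<dots> = of_nat (Suc l) * s (Suc l) + of_nat l * s l - of_nat (y i0) * s l"
      unfolding s_def by (simp only: sum.distrib sum_subtractf sum_distrib_left)
    finally show ?thesis .
  qed
  have "c dvd (\<Sum>i\<in>I. v' i * of_nat (y i choose l))" if "l < card I" for l
    unfolding sum' using s[of l] s[of "Suc l"] that insert.hyps by (intro dvd_add dvd_diff dvd_mult) auto
  then have v': "c dvd v' i" if "i \<in> I" for i
    using insert.IH[of v' i] insert.prems that by auto
  have v: "c dvd v i" if i: "i \<in> I" for i
  proof -
    \<comment> \<open>Distinct numbers below \<open>p\<close> differ by a nonmultiple of
      \<open>p\<close>, so the factor in \<open>v'\<close> is a unit modulo
      \<open>c\<close>.\<close>
    have "y i \<noteq> y i0" "y i < p" "y i0 < p" using insert.prems insert.hyps i by (auto simp: inj_on_def)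
    then have "\<not> int p dvd int (y i) - int (y i0)"
      using dvd_imp_le_int[of "int (y i) - int (y i0)" "int p"] by auto
    then show ?thesis using dvd_cancel_of_int[OF p] v'[OF i] unfolding v'_def by blast
  qed
  \<comment> \<open>The equation for index 0 is the plain sum of the unknowns and recovers the
    eliminated one.\<close>
  have "c dvd s 0" using insert.hyps by (intro s) (simp add: card_gt_0_iff)
  then have "c dvd v i0 + (\<Sum>i\<in>I. v i)" using insert.hyps by (simp add: s_def)
  moreover have "c dvd (\<Sum>i\<in>I. v i)" using v by (rule dvd_sum)
  ultimately have "c dvd v i0" by (simp add: dvd_add_left_iff)
  with v insert.prems show ?case by auto
qed simp

section \<open>Taylor coefficients at 1 and the element 1 - \<xi>\<close>

lemma one_minus_dvd_one_minus_power:
  "(1 - x) dvd (1 - x ^ n)" for x :: "'a :: comm_ring_1"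
  by (simp add: one_diff_power_eq)

text \<open>The hypothesis \<open>sys\<close> isolates what is needed about order \<open>M\<close>:
  Fourier systems on subsets of residues have only the zero solution modulo
  \<open>1 - \<xi>\<close>. The size of \<open>p\<close> enters only where \<open>sys\<close> is
  verified.\<close>

lemma kernel_vector_dvd:
  fixes \<zeta> \<xi> :: "'a :: idom"
  assumes sys: "\<And>S w x. S \<subseteq> {..<M} \<Longrightarrow> (\<And>x. x \<in> S \<Longrightarrow> 1 - \<xi> dvd (\<Sum>y\<in>S. \<zeta> ^ (x * y) * w y)) \<Longrightarrow> x \<in> S \<Longrightarrow> 1 - \<xi> dvd w x"
    and \<zeta>: "\<zeta> ^ M = 1" and \<xi>: "primitive_root_unity p \<xi>"
    and p: "prime p" "1 - \<xi> dvd of_nat p"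
    and M: "M > 0" "coprime M p"
    and K: "K \<subseteq> {..<M * p}"
    and ker: "\<And>a. a \<in> K \<Longrightarrow> (\<Sum>b\<in>K. \<zeta> ^ (a * b) * \<xi> ^ (a * b) * v b) = 0"
    and b: "b \<in> K"
  shows "1 - \<xi> dvd v b"
proof -
  have p0: "p > 0" using p(1) by (simp add: prime_gt_0_nat)
  have fin: "finite K" using K finite_subset by blast
  define B where "B = (\<lambda>x. {b \<in> K. b mod M = x})"
  have finB: "finite (B x)" for x using fin by (simp add: B_def)
  \<comment> \<open>\<open>h x l\<close> is the \<open>l\<close>-th Taylor coefficient at \<open>1\<close> of the polynomial with coefficients
    \<open>v b\<close> and exponents \<open>b mod p\<close>, where \<open>b\<close> ranges over \<open>B x\<close>.\<close>
  define h where "h = (\<lambda>x l. \<Sum>b\<in>B x. v b * of_nat (b mod p choose l))"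
  have red: "\<zeta> ^ (x * (b mod M)) = \<zeta> ^ (x * b)" "\<zeta> ^ ((a mod M) * b) = \<zeta> ^ (a * b)" for x a b
  proof -
    have *: "\<zeta> ^ (x * (b mod M)) = \<zeta> ^ (x * b)" for x b
    proof -
      have "\<zeta> ^ b = (\<zeta> ^ M) ^ (b div M) * \<zeta> ^ (b mod M)"
        by (metis mult_div_mod_eq power_add power_mult)
      then have "\<zeta> ^ b = \<zeta> ^ (b mod M)" using \<zeta> by simp
      then show ?thesis by (metis mult.commute power_mult)
    qed
    show "\<zeta> ^ (x * (b mod M)) = \<zeta> ^ (x * b)" "\<zeta> ^ ((a mod M) * b) = \<zeta> ^ (a * b)"
      using *[of x b] *[of b a] by (simp_all add: mult.commute)
  qed
  have redx: "\<xi> ^ (a * (b mod p)) = \<xi> ^ (a * b)" for a b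
    using primitive_root_unity_power_eq_iff[OF \<xi> p0] by (simp add: cong_def mod_mult_right_eq)
  \<comment> \<open>By the Chinese remainder theorem, the elements of one class modulo
    \<open>M\<close> are told apart by their residues modulo \<open>p\<close>.\<close>
  have inj: "b = b'" if "b \<in> B x" "b' \<in> B x" "[b = b'] (mod p)" for x b b'
  proof -
    have "[b = b'] (mod M)" using that by (simp add: B_def cong_def)
    then have "[b = b'] (mod M * p)" using that(3) M(2) by (rule coprime_cong_mult_nat)
    moreover have "b < M * p" "b' < M * p" using that K by (auto simp: B_def)
    ultimately show ?thesis by (simp add: cong_def)
  qed
  have g: "1 - \<xi> dvd (\<Sum>y<M. \<zeta> ^ (x * y) * h y l)" if x: "l < card (B x)" for x l
  proof -
    \<comment> \<open>The variable is shifted by 1: coefficients of \<open>G\<close> are Taylor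
      coefficients at 1, and a root \<open>\<xi> ^ a\<close> becomes \<open>\<xi> ^ a - 1\<close>, a
      multiple of \<open>1 - \<xi>\<close>.\<close>
    define G where "G = (\<Sum>b\<in>K. smult (\<zeta> ^ (x * b) * v b) ([:1, 1:] ^ (b mod p)))"
    have "(\<Sum>y<M. \<zeta> ^ (x * y) * h y l)
        = (\<Sum>y<M. \<Sum>b\<in>B y. \<zeta> ^ (x * b) * v b * of_nat (b mod p choose l))"
      unfolding h_def sum_distrib_left
      by (intro sum.cong refl) (auto simp: B_def red mult.assoc)
    also have "\<dots> = (\<Sum>b\<in>K. \<zeta> ^ (x * b) * v b * of_nat (b mod p choose l))"
      unfolding B_def using fin M(1) by (intro sum.group) auto
    also have "\<dots> = coeff G l"
      by (simp add: G_def coeff_sum coeff_one_plus_X_power)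
    finally have eq: "(\<Sum>y<M. \<zeta> ^ (x * y) * h y l) = coeff G l" .
    define R where "R = (\<lambda>a. \<xi> ^ a - 1) ` B x"
    have "inj_on (\<lambda>a. \<xi> ^ a - 1) (B x)"
      using primitive_root_unity_power_eq_iff[OF \<xi> p0] inj by (auto intro!: inj_onI)
    then have cardR: "card R = card (B x)" by (simp add: R_def card_image)
    have "poly G r = 0" if "r \<in> R" for r
    proof -
      from that obtain a where a: "a \<in> B x" "r = \<xi> ^ a - 1" by (auto simp: R_def)
      have "poly G r = (\<Sum>b\<in>K. \<zeta> ^ (x * b) * v b * (\<xi> ^ a) ^ (b mod p))"
        by (simp add: G_def poly_sum a)
      also have "\<dots> = (\<Sum>b\<in>K. \<zeta> ^ (a * b) * \<xi> ^ (a * b) * v b)"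
      proof (intro sum.cong refl)
        fix b
        have "\<zeta> ^ (x * b) = \<zeta> ^ (a * b)" using a(1) red(2)[of a b] by (auto simp: B_def)
        then show "\<zeta> ^ (x * b) * v b * (\<xi> ^ a) ^ (b mod p) = \<zeta> ^ (a * b) * \<xi> ^ (a * b) * v b"
          by (simp add: redx mult_ac flip: power_mult)
      qed
      also have "\<dots> = 0" using ker a(1) by (simp add: B_def)
      finally show ?thesis .
    qed
    moreover have "1 - \<xi> dvd r" if "r \<in> R" for r
    proof -
      from that obtain a where "r = - (1 - \<xi> ^ a)" by (auto simp: R_def)
      then show ?thesis using one_minus_dvd_one_minus_power by (metis dvd_minus_iff)
    qed
    ultimately show ?thesis
      unfolding eq using finB x cardR by (intro dvd_coeff_of_roots[of R]) (auto simp: R_def)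
  qed
  \<comment> \<open>There are now as many binomial equations as unknowns in \<open>B x\<close>, with
    distinct nodes below \<open>p\<close>.\<close>
  have block: "1 - \<xi> dvd v b" if "\<And>l. l < card (B x) \<Longrightarrow> 1 - \<xi> dvd h x l" "b \<in> B x" for x b
  proof (rule binomial_system_dvd[OF p finB[of x], of "\<lambda>b. b mod p"])
    show "inj_on (\<lambda>b. b mod p) (B x)" using inj by (auto simp: inj_on_def cong_def)
  qed (use that p0 in \<open>auto simp: h_def\<close>)
  have h: "\<forall>x<M. 1 - \<xi> dvd h x l" for l
  proof (induction l rule: less_induct)
    case (less l)
    define S where "S = {x. x < M \<and> l < card (B x)}"
    \<comment> \<open>Outside \<open>S\<close> the class has at most \<open>l\<close> elements, so
      the coefficients of index below \<open>l\<close> already determine it modulo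
      \<open>1 - \<xi>\<close>.\<close>
    have out: "1 - \<xi> dvd h x l" if "x < M" "x \<notin> S" for x
      unfolding h_def using that less by (intro dvd_sum dvd_mult2 block[of x]) (auto simp: S_def)
    have "1 - \<xi> dvd (\<Sum>y\<in>S. \<zeta> ^ (x * y) * h y l)" if "x \<in> S" for x
    proof -
      have "(\<Sum>y<M. \<zeta> ^ (x * y) * h y l) = (\<Sum>y\<in>S. \<zeta> ^ (x * y) * h y l) + (\<Sum>y\<in>{..<M} - S. \<zeta> ^ (x * y) * h y l)"
        by (subst add.commute, rule sum.subset_diff) (auto simp: S_def)
      moreover have "1 - \<xi> dvd (\<Sum>y\<in>{..<M} - S. \<zeta> ^ (x * y) * h y l)"
        using out by (intro dvd_sum dvd_mult) auto
      ultimately show ?thesis using g[of l x] that by (simp add: S_def dvd_add_left_iff)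
    qed
    then have "1 - \<xi> dvd h x l" if "x \<in> S" for x
      using sys[of S "\<lambda>y. h y l" x] that by (auto simp: S_def)
    with out show ?case by blast
  qed
  show ?thesis
    by (rule block[of "b mod M"]) (use h b M(1) in \<open>auto simp: B_def\<close>)
qed

text \<open>The powers of \<open>\<xi>\<close> sum to 0, so \<open>p\<close> is the sum of the
  \<open>1 - \<xi> ^ k\<close>.\<close>

lemma one_minus_root_dvd:
  fixes \<xi> :: "'a :: idom"
  assumes "\<xi> ^ p = 1" "\<xi> \<noteq> 1"
  shows "1 - \<xi> dvd of_nat p"
proof -
  have "(1 - \<xi>) * (\<Sum>k<p. \<xi> ^ k) = 0"
    using assms(1) by (simp flip: one_diff_power_eq)
  then have "(\<Sum>k<p. \<xi> ^ k) = 0" using assms(2) by simp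
  then have "of_nat p = (\<Sum>k<p. 1 - \<xi> ^ k)" by (simp add: sum_subtractf)
  then show ?thesis by (simp add: dvd_sum one_minus_dvd_one_minus_power)
qed

text \<open>In the binomial expansion the inner coefficients are multiples of \<open>p\<close>; the
  two outer terms sum to 0 for odd \<open>p\<close> and to 2 for \<open>p = 2\<close>.\<close>

lemma prime_dvd_one_minus_root_power:
  fixes \<xi> :: "'a :: comm_ring_1"
  assumes p: "prime p" and \<xi>: "\<xi> ^ p = 1"
  shows "of_nat p dvd (1 - \<xi>) ^ p"
proof -
  have p1: "p > 1" using p by (rule prime_gt_1_nat)
  have "(1 - \<xi>) ^ p = (\<Sum>k\<le>p. of_nat (p choose k) * (- \<xi>) ^ k)"
    using binomial_ring[of "- \<xi>" 1 p] by simp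
  also have "\<dots> = (\<Sum>k\<in>{0<..<p}. of_nat (p choose k) * (- \<xi>) ^ k) + (1 + (- \<xi>) ^ p)"
  proof -
    have "{..p} = insert 0 (insert p {0<..<p})" using p1 by auto
    then show ?thesis using p1 by simp
  qed
  finally have eq: "(1 - \<xi>) ^ p = \<dots>" .
  have "of_nat p dvd (\<Sum>k\<in>{0<..<p}. of_nat (p choose k) * (- \<xi>) ^ k)"
  proof (intro dvd_sum dvd_mult2)
    fix k assume "k \<in> {0<..<p}"
    then have "p dvd (p choose k)" using p by (intro dvd_choose_prime) auto
    then obtain m where "p choose k = p * m" by blast
    then show "(of_nat p :: 'a) dvd of_nat (p choose k)" by simp
  qed
  moreover have "of_nat p dvd 1 + (- \<xi>) ^ p"
  proof (cases "p = 2")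
    case True
    then show ?thesis using \<xi> by simp
  next
    case False
    then have "odd p" using p p1 by (simp add: prime_odd_nat)
    then show ?thesis using \<xi> by simp
  qed
  ultimately show ?thesis unfolding eq by (rule dvd_add)
qed

section \<open>Invertibility of minors and the induction step\<close>

text \<open>
  Quantifying over all primitive roots makes the induction hypothesis cover every Galois conjugate
  of a minor, so irreducibility of cyclotomic polynomials is never needed.
\<close>
definition nonvanishing_minors :: "nat \<Rightarrow> bool" where
  "nonvanishing_minors M \<longleftrightarrow> (\<forall>\<zeta> :: alg_int. primitive_root_unity M \<zeta> \<longrightarrow>
     (\<forall>S\<subseteq>{..<M}. det (family_mat (\<lambda>a b. \<zeta> ^ (a * b)) S) \<noteq> 0))"

lemma norm_minor_bound:
  fixes z :: complex
  assumes z: "primitive_root_unity M z" and M: "M > 0"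
  shows "(norm (det (family_mat (\<lambda>a b. z ^ (a * b)) S)))\<^sup>2 \<le> real (card S) ^ card S"
proof (rule hadamard_bound[OF family_mat_carrier])
  have "z ^ M = 1" using z by (simp add: primitive_root_unity_def)
  then have "norm z ^ M = 1" by (metis norm_one norm_power)
  then have "norm z = 1" using power_eq_imp_eq_base[of "norm z" M 1] M by simp
  then show "norm (family_mat (\<lambda>a b. z ^ (a * b)) S $$ (i, j)) \<le> 1"
    if "i < card S" "j < card S" for i j
    using that by (simp add: family_mat_def norm_power)
qed

text \<open>\<open>n\<close> is the product of the minor over all primitive roots. It is nonzero
  because every conjugate minor is, and Hadamard's bound makes its absolute value less than
  \<open>p\<close>.\<close>

lemma small_minor_dvd_int:
  fixes \<zeta> :: alg_int
  assumes good: "nonvanishing_minors M" and M: "M > 0" and \<zeta>: "primitive_root_unity M \<zeta>"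
    and S: "S \<subseteq> {..<M}" "2 * card S \<le> M"
    and p: "prime p" "real p > (real M / 2) powr (real (M * totient M) / 4)"
  obtains n where "\<not> int p dvd n" "det (family_mat (\<lambda>a b. \<zeta> ^ (a * b)) S) dvd of_int n"
proof -
  let ?P = "{x :: alg_int. primitive_root_unity M x}"
  let ?D = "\<lambda>x :: alg_int. det (family_mat (\<lambda>a b. x ^ (a * b)) S)"
  define f :: "int poly" where "f = det (family_mat (\<lambda>a b. monom 1 (a * b)) S)"
  have f: "poly (map_poly of_int f) x = ?D x" for x
  proof -
    interpret ev: comm_ring_hom "\<lambda>q :: int poly. poly (map_poly of_int q) x"
      by standard (simp_all add: hom_distribs)
    show ?thesis
      unfolding f_def ev.hom_det_family_mat by (simp add: poly_monom)
  qed
  obtain n where n: "(\<Prod>x\<in>?P. ?D x) = of_int n"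
    using prod_primitive_roots_poly_int[OF \<zeta> M, of f] unfolding f by blast
  have finP: "finite ?P" by (rule finite_primitive_roots_unity[OF \<zeta> M])
  have "?D x \<noteq> 0" if "x \<in> ?P" for x
    using good S(1) that by (simp add: nonvanishing_minors_def)
  then have "(\<Prod>x\<in>?P. ?D x) \<noteq> 0" using finP by simp
  then have n0: "n \<noteq> 0" unfolding n by simp
  \<comment> \<open>The empty minor is 1, whereas the formula gives a value below 1 when
    \<open>M = 1\<close>.\<close>
  define B where "B = (if S = {} then 1 else (real M / 2) powr (real M / 4))"
  have "norm (complex_of_alg (?D x)) \<le> B" if "x \<in> ?P" for x
  proof -
    have "primitive_root_unity M (complex_of_alg x)"
      using that by (simp add: primitive_root_unity_def flip: complex_of_alg.hom_power)
    then have le: "(norm (complex_of_alg (?D x)))\<^sup>2 \<le> real (card S) ^ card S"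
      using norm_minor_bound[of M "complex_of_alg x" S] M
      by (simp add: complex_of_alg.hom_det_family_mat complex_of_alg.hom_power)
    show ?thesis
    proof (cases "S = {}")
      case True
      with le show ?thesis by (simp add: B_def power_le_one_iff)
    next
      case False
      have "finite S" using S(1) finite_subset by blast
      with False have s: "card S > 0" by (simp add: card_gt_0_iff)
      note le
      also have "real (card S) ^ card S = real (card S) powr real (card S)"
        using s by (simp add: powr_realpow)
      also have "\<dots> \<le> (real M / 2) powr real (card S)"
        using s S(2) by (intro powr_mono2) auto
      \<comment> \<open>Raising the exponent needs a base of at least 1: a nonempty \<open>S\<close>
        forces \<open>M\<close> to be at least 2.\<close>
      also have "\<dots> \<le> (real M / 2) powr (real M / 2)"
        using s S(2) by (intro powr_mono) auto
      also have "\<dots> = B\<^sup>2"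
        using False M by (simp add: B_def power2_eq_square flip: powr_add)
      finally show ?thesis
        by (rule power2_le_imp_le) (simp add: B_def)
    qed
  qed
  then have "(\<Prod>x\<in>?P. norm (complex_of_alg (?D x))) \<le> (\<Prod>x\<in>?P. B)"
    by (intro prod_mono) auto
  also have "\<dots> = B ^ totient M"
    using card_primitive_roots_unity[OF \<zeta> M] by simp
  also have "\<dots> < real p"
  proof (cases "S = {}")
    case True
    then show ?thesis using prime_gt_1_nat[OF p(1)] by (simp add: B_def)
  next
    case False
    then have "B ^ totient M = (real M / 2) powr (real (M * totient M) / 4)"
      using M by (simp add: B_def powr_powr flip: powr_realpow)
    then show ?thesis using p(2) by simp
  qed
  also have "(\<Prod>x\<in>?P. norm (complex_of_alg (?D x))) = norm (complex_of_alg (\<Prod>x\<in>?P. ?D x))"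
    by (simp add: complex_of_alg.hom_prod prod_norm)
  also have "\<dots> = real_of_int \<bar>n\<bar>" unfolding n by (simp add: hom_distribs)
  finally have "\<bar>n\<bar> < int p" by linarith
  then have "\<not> int p dvd n" using n0 dvd_imp_le_int[of n "int p"] by auto
  moreover have "?D \<zeta> dvd of_int n"
    unfolding n[symmetric] using finP \<zeta> by (intro dvd_prodI) auto
  ultimately show thesis by (rule that)
qed

text \<open>Cramer's rule gives \<open>c dvd of_int n * w x\<close>, and \<open>n\<close> is a unit
  modulo \<open>c\<close>.\<close>

lemma small_system_dvd:
  fixes \<zeta> c :: alg_int
  assumes "nonvanishing_minors M" "M > 0" "primitive_root_unity M \<zeta>"
    and S: "S \<subseteq> {..<M}" "2 * card S \<le> M"
    and p: "prime p" "real p > (real M / 2) powr (real (M * totient M) / 4)" "c dvd of_nat p"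
    and dvd: "\<And>x. x \<in> S \<Longrightarrow> c dvd (\<Sum>y\<in>S. \<zeta> ^ (x * y) * w y)" and x: "x \<in> S"
  shows "c dvd w x"
proof -
  obtain n where n: "\<not> int p dvd n" "det (family_mat (\<lambda>a b. \<zeta> ^ (a * b)) S) dvd of_int n"
    using small_minor_dvd_int[OF assms(1-7)] by blast
  have "finite S" using S(1) finite_subset by blast
  then have "c dvd det (family_mat (\<lambda>a b. \<zeta> ^ (a * b)) S) * w x"
    using dvd x by (intro det_family_mat_mult_dvd) auto
  also have "\<dots> dvd of_int n * w x" using n(2) by (rule mult_dvd_mono) simp
  finally show ?thesis by (rule dvd_cancel_of_int[OF p(1,3) n(1)])
qed

text \<open>Orthogonality of the characters of \<int>/M, with \<open>\<zeta> ^ (M - 1)\<close> as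
  the inverse of \<open>\<zeta>\<close>.\<close>

lemma fourier_inversion:
  fixes \<zeta> :: "'a :: idom"
  assumes \<zeta>: "primitive_root_unity M \<zeta>" and z: "z < M"
  shows "(\<Sum>x<M. (\<zeta> ^ (M - 1)) ^ (z * x) * (\<Sum>y<M. \<zeta> ^ (x * y) * w y)) = of_nat M * w z"
proof -
  have geo: "(\<Sum>x<M. (\<zeta> ^ ((M - 1) * z + y)) ^ x) = (if y = z then of_nat M else 0)" if y: "y < M" for y
  proof -
    let ?e = "(M - 1) * z + y"
    have "[?e + z = M * z + y] (mod M)"
      using z by (cases M) (auto simp: algebra_simps)
    then have 1: "[?e + z = y] (mod M)" by (simp add: cong_def)
    have "\<zeta> ^ ?e = 1 \<longleftrightarrow> [?e = 0] (mod M)"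
      using primitive_root_unityD[OF \<zeta>] by (simp add: cong_0_iff)
    also have "\<dots> \<longleftrightarrow> [?e + z = 0 + z] (mod M)"
      by (rule cong_add_rcancel_nat[symmetric])
    also have "\<dots> \<longleftrightarrow> [y = z] (mod M)" using 1 by (simp add: cong_def)
    also have "\<dots> \<longleftrightarrow> y = z" using y z by (simp add: cong_def)
    finally have iff: "\<zeta> ^ ?e = 1 \<longleftrightarrow> y = z" .
    show ?thesis
    proof (cases "y = z")
      case True
      then have "\<zeta> ^ ?e = 1" using iff by simp
      then show ?thesis using True by simp
    next
      case False
      have "(1 - \<zeta> ^ ?e) * (\<Sum>x<M. (\<zeta> ^ ?e) ^ x) = 1 - (\<zeta> ^ ?e) ^ M"
        by (rule one_diff_power_eq[symmetric])
      also have "\<dots> = 0"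
        using primitive_root_unityD[OF \<zeta>, of "?e * M"] by (simp add: power_mult)
      finally show ?thesis using False iff by simp
    qed
  qed
  have "(\<Sum>x<M. (\<zeta> ^ (M - 1)) ^ (z * x) * (\<Sum>y<M. \<zeta> ^ (x * y) * w y))
      = (\<Sum>x<M. \<Sum>y<M. w y * (\<zeta> ^ ((M - 1) * z + y)) ^ x)"
    unfolding sum_distrib_left
    by (intro sum.cong refl) (simp add: algebra_simps flip: power_mult power_add)
  also have "\<dots> = (\<Sum>y<M. w y * (\<Sum>x<M. (\<zeta> ^ ((M - 1) * z + y)) ^ x))"
    by (subst sum.swap) (simp add: sum_distrib_left)
  also have "\<dots> = (\<Sum>y<M. if y = z then w y * of_nat M else 0)"
    by (intro sum.cong refl) (simp add: geo del: One_nat_def)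
  also have "\<dots> = of_nat M * w z" using z by simp
  finally show ?thesis .
qed

text \<open>
  If \<open>S\<close> is large, extend \<open>w\<close> by zero: its Fourier transform vanishes on \<open>S\<close> modulo \<open>c\<close>, and
  the inverse transform gives a system on the small complement of \<open>S\<close>. This is where the constant
  \<open>M / 2\<close> comes from.
\<close>
lemma fourier_system_dvd:
  fixes \<zeta> c :: alg_int
  assumes good: "nonvanishing_minors M" and M: "M > 0" "coprime M p" and \<zeta>: "primitive_root_unity M \<zeta>"
    and p: "prime p" "real p > (real M / 2) powr (real (M * totient M) / 4)" "c dvd of_nat p"
    and S: "S \<subseteq> {..<M}"
    and dvd: "\<And>x. x \<in> S \<Longrightarrow> c dvd (\<Sum>y\<in>S. \<zeta> ^ (x * y) * w y)" and x: "x \<in> S"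
  shows "c dvd w x"
proof (cases "2 * card S \<le> M")
  case True
  then show ?thesis using small_system_dvd[OF good M(1) \<zeta> S _ p dvd x] by simp
next
  case False
  define T where "T = {..<M} - S"
  have T: "T \<subseteq> {..<M}" by (auto simp: T_def)
  have "card S \<le> M" using card_mono[OF _ S] by simp
  moreover have "card T = M - card S"
    unfolding T_def using S finite_subset[OF S] by (simp add: card_Diff_subset)
  ultimately have cT: "2 * card T \<le> M" using False by simp
  let ?\<zeta>' = "\<zeta> ^ (M - 1)"
  have \<zeta>': "primitive_root_unity M ?\<zeta>'"
    using M(1) by (intro primitive_root_unity_coprime_power[OF \<zeta>]) (rule coprime_diff_one_left_nat)
  define w0 where "w0 = (\<lambda>y. if y \<in> S then w y else 0)"
  define u where "u = (\<lambda>x. \<Sum>y<M. \<zeta> ^ (x * y) * w0 y)"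
  have u: "u x = (\<Sum>y\<in>S. \<zeta> ^ (x * y) * w y)" for x
    unfolding u_def w0_def using S by (intro sum.mono_neutral_cong_right) auto
  have uS: "c dvd u x" if "x \<in> S" for x using dvd that by (simp add: u)
  have inv: "(\<Sum>x<M. ?\<zeta>' ^ (z * x) * u x) = of_nat M * w0 z" if "z < M" for z
    unfolding u_def by (rule fourier_inversion[OF \<zeta> that])
  have "c dvd (\<Sum>x\<in>T. ?\<zeta>' ^ (z * x) * u x)" if z: "z \<in> T" for z
  proof -
    have "(\<Sum>x\<in>T. ?\<zeta>' ^ (z * x) * u x) + (\<Sum>x\<in>S. ?\<zeta>' ^ (z * x) * u x)
        = (\<Sum>x<M. ?\<zeta>' ^ (z * x) * u x)"
      unfolding T_def by (rule sum.subset_diff[OF S, symmetric]) simp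
    also have "\<dots> = 0"
      using inv[of z] z by (simp add: T_def w0_def)
    finally have "c dvd (\<Sum>x\<in>T. ?\<zeta>' ^ (z * x) * u x) + (\<Sum>x\<in>S. ?\<zeta>' ^ (z * x) * u x)"
      by simp
    moreover have "c dvd (\<Sum>x\<in>S. ?\<zeta>' ^ (z * x) * u x)"
      using uS by (intro dvd_sum dvd_mult) auto
    ultimately show ?thesis by (simp only: dvd_add_left_iff)
  qed
  \<comment> \<open>The inverse transform uses another primitive root, which the small case also
    covers. Hence the transform \<open>u\<close> vanishes modulo \<open>c\<close> on
    \<open>T\<close> as well.\<close>
  then have uT: "c dvd u x" if "x \<in> T" for x
    using small_system_dvd[OF good M(1) \<zeta>' T cT p, of u] that by blast
  have "c dvd u y" if "y < M" for y using uS uT that by (auto simp: T_def)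
  then have "c dvd (\<Sum>y<M. ?\<zeta>' ^ (x * y) * u y)" by (intro dvd_sum dvd_mult) auto
  then have "c dvd of_nat M * w0 x" using inv[of x] x S by auto
  then have "c dvd of_int (int M) * w x" using x by (simp add: w0_def)
  moreover have "\<not> int p dvd int M"
    using M(2) p(1) by (metis coprime_commute not_prime_unit coprime_common_divisor dvd_refl int_dvd_int_iff)
  ultimately show ?thesis by (rule dvd_cancel_of_int[OF p(1,3), rotated])
qed

lemma nonvanishing_minors_mult_prime:
  assumes good: "nonvanishing_minors M" and M: "M > 0" "coprime M p"
    and p: "prime p" "real p > (real M / 2) powr (real (M * totient M) / 4)"
  shows "nonvanishing_minors (M * p)"
  unfolding nonvanishing_minors_def
proof (intro allI impI notI)
  fix \<eta> :: alg_int and K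
  assume \<eta>: "primitive_root_unity (M * p) \<eta>" and K: "K \<subseteq> {..<M * p}"
    and det: "det (family_mat (\<lambda>a b. \<eta> ^ (a * b)) K) = 0"
  have p0: "p > 0" and p1: "p > 1" using p(1) prime_gt_1_nat[of p] by auto
  \<comment> \<open>Inverses of \<open>p\<close> modulo \<open>M\<close> and of \<open>M\<close>
    modulo \<open>p\<close> make p e1 + M e2 congruent to 1 modulo M p, which splits
    \<open>\<eta>\<close> as \<open>\<zeta> * \<xi>\<close>.\<close>
  obtain e1 where e1: "[p * e1 = 1] (mod M)"
    using cong_solve_coprime_nat[of p M] M(2) by (auto simp: coprime_commute)
  obtain e2 where e2: "[M * e2 = 1] (mod p)"
    using cong_solve_coprime_nat[of M p] M(2) by auto
  have cop: "coprime e1 M" "coprime e2 p"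
    using e1 e2 by (auto simp: coprime_iff_invertible_nat mult.commute)
  define \<zeta> \<xi> where "\<zeta> = (\<eta> ^ p) ^ e1" and "\<xi> = (\<eta> ^ M) ^ e2"
  have \<zeta>: "primitive_root_unity M \<zeta>"
    unfolding \<zeta>_def using primitive_root_unity_power[OF \<eta> p0] cop(1)
    by (rule primitive_root_unity_coprime_power)
  have \<xi>: "primitive_root_unity p \<xi>"
    unfolding \<xi>_def using primitive_root_unity_power[OF \<eta>[unfolded mult.commute[of M]] M(1)] cop(2)
    by (rule primitive_root_unity_coprime_power)
  have "[p * e1 + M * e2 = 1] (mod M * p)"
  proof (rule coprime_cong_mult_nat[OF _ _ M(2)])
    show "[p * e1 + M * e2 = 1] (mod M)" using e1 by (simp add: cong_def)
    show "[p * e1 + M * e2 = 1] (mod p)" using e2 by (simp add: cong_def)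
  qed
  then have "\<eta> ^ (p * e1 + M * e2) = \<eta> ^ 1"
    by (rule primitive_root_unity_power_eq_iff[OF \<eta>, THEN iffD2, rotated]) (use M(1) p0 in simp)
  then have "\<eta> = \<zeta> * \<xi>" by (simp add: \<zeta>_def \<xi>_def power_add power_mult)
  then have \<eta>_power: "\<eta> ^ k = \<zeta> ^ k * \<xi> ^ k" for k by (simp add: power_mult_distrib)
  have \<zeta>M: "\<zeta> ^ M = 1" using \<zeta> by (simp add: primitive_root_unity_def)
  have \<xi>p: "\<xi> ^ p = 1" using \<xi> by (simp add: primitive_root_unity_def)
  have \<xi>1: "\<xi> \<noteq> 1" using primitive_root_unityD[OF \<xi>, of 1] p1 by auto
  define c where "c = 1 - \<xi>"
  have c0: "c \<noteq> 0" using \<xi>1 by (simp add: c_def)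
  have cp: "c dvd of_nat p" unfolding c_def by (rule one_minus_root_dvd[OF \<xi>p \<xi>1])
  have finK: "finite K" using K finite_subset by blast
  obtain v where v: "\<exists>b\<in>K. v b \<noteq> 0" "\<And>a. a \<in> K \<Longrightarrow> (\<Sum>b\<in>K. \<eta> ^ (a * b) * v b) = 0"
    using det_family_mat_0_imp_kernel[OF finK det] by blast
  have step: "c dvd v b" if "\<And>a. a \<in> K \<Longrightarrow> (\<Sum>b\<in>K. \<eta> ^ (a * b) * v b) = 0" "b \<in> K" for v b
    unfolding c_def
  proof (rule kernel_vector_dvd[OF _ \<zeta>M \<xi> p(1) _ M K _ that(2)])
    show "1 - \<xi> dvd w x"
      if "S \<subseteq> {..<M}" "\<And>x. x \<in> S \<Longrightarrow> 1 - \<xi> dvd (\<Sum>y\<in>S. \<zeta> ^ (x * y) * w y)" "x \<in> S" for S w x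
      using fourier_system_dvd[OF good M \<zeta> p, of c S w x] cp that by (simp add: c_def)
  qed (use that cp in \<open>auto simp: \<eta>_power c_def\<close>)
  \<comment> \<open>Descent: \<open>c\<close> is nonzero and can be cancelled, so the quotient of a
    kernel vector by \<open>c\<close> is again a kernel vector.\<close>
  have "\<forall>b\<in>K. c ^ m dvd v b" if "\<And>a. a \<in> K \<Longrightarrow> (\<Sum>b\<in>K. \<eta> ^ (a * b) * v b) = 0" for m v
    using that
  proof (induction m arbitrary: v)
    case (Suc m)
    have "\<forall>b\<in>K. \<exists>w. v b = c * w" using step[of v] Suc.prems unfolding dvd_def by blast
    then obtain w where w: "\<And>b. b \<in> K \<Longrightarrow> v b = c * w b" by metis
    have "(\<Sum>b\<in>K. \<eta> ^ (a * b) * w b) = 0" if "a \<in> K" for a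
    proof -
      have "c * (\<Sum>b\<in>K. \<eta> ^ (a * b) * w b) = (\<Sum>b\<in>K. \<eta> ^ (a * b) * v b)"
        unfolding sum_distrib_left by (intro sum.cong refl) (simp add: w)
      then show ?thesis using Suc.prems[OF that] c0 by simp
    qed
    then have "\<forall>b\<in>K. c ^ m dvd w b" by (rule Suc.IH)
    then show ?case using w by (auto intro: mult_dvd_mono)
  qed simp
  then have all: "c ^ m dvd v b" if "b \<in> K" for m b using v(2) that by blast
  obtain b where b: "b \<in> K" "v b \<noteq> 0" using v(1) by blast
  obtain n :: int where n: "n \<noteq> 0" "v b dvd of_int n" using alg_int_dvd_int[OF b(2)] by blast
  \<comment> \<open>Any exponent with p^m > |n| suffices; \<open>c ^ (p * m)\<close> is a multiple
    of \<open>p ^ m\<close> and divides \<open>n\<close>.\<close>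
  define m where "m = nat \<bar>n\<bar>"
  have "(of_nat p :: alg_int) ^ m dvd (c ^ p) ^ m"
    unfolding c_def by (intro dvd_power_same prime_dvd_one_minus_root_power p(1) \<xi>p)
  also have "\<dots> dvd of_int n"
    using all[OF b(1), of "p * m"] n(2) by (metis dvd_trans power_mult)
  finally have "(of_int (int p ^ m) :: alg_int) dvd of_int n" by simp
  then have "int p ^ m dvd n" unfolding of_int_dvd_of_int_alg_int_iff .
  then have "\<bar>int p ^ m\<bar> \<le> \<bar>n\<bar>" by (rule dvd_imp_le_int[OF n(1)])
  moreover have "int m < int p ^ m"
    using power_gt_expt[of p m] p1 by (simp flip: of_nat_power)
  ultimately show False by (simp add: m_def)
qed

text \<open>Start of the induction at the empty product of primes: the only possible entry is
  \<open>\<zeta> ^ 0 = 1\<close>.\<close>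

lemma nonvanishing_minors_1: "nonvanishing_minors 1"
  unfolding nonvanishing_minors_def
proof (intro allI impI notI)
  fix \<zeta> :: alg_int and S
  assume "S \<subseteq> {..<1 :: nat}" and det: "det (family_mat (\<lambda>a b. \<zeta> ^ (a * b)) S) = 0"
  then have S: "S \<subseteq> {0}" by auto
  then have "finite S" using finite_subset by blast
  then obtain v where "\<exists>b\<in>S. v b \<noteq> 0" "\<And>a. a \<in> S \<Longrightarrow> (\<Sum>b\<in>S. \<zeta> ^ (a * b) * v b) = 0"
    using det_family_mat_0_imp_kernel[OF _ det] by blast
  moreover from this S have "S = {0}" by auto
  ultimately show False by simp
qed

section \<open>From algebraic integers back to the Fourier matrix\<close>

lemma primitive_root_unity_exp:
  assumes "N > 0"
  shows "primitive_root_unity N (exp (- 2 * of_real pi * \<i> / of_nat N))"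
  unfolding primitive_root_unity_def
proof
  fix k
  have "exp (- 2 * of_real pi * \<i> / of_nat N) ^ k = exp (- (2 * of_real pi * \<i> * of_nat k / of_nat N))"
    by (subst exp_of_nat_mult[symmetric]) (simp add: mult_ac)
  also have "\<dots> = 1 \<longleftrightarrow> exp (2 * of_real pi * \<i> * of_nat k / of_nat N) = 1"
    by (simp only: exp_minus inverse_eq_1_iff)
  also have "\<dots> \<longleftrightarrow> N dvd k"
    using assms by (intro complex_root_unity_eq_1) simp
  finally show "exp (- 2 * of_real pi * \<i> / of_nat N) ^ k = 1 \<longleftrightarrow> N dvd k" .
qed

text \<open>The root \<omega> is an algebraic integer, so the minor is the image of one over
  \<open>alg_int\<close> under an injective ring homomorphism.\<close>

lemma principal_minor_fourier_nonzero:
  assumes good: "nonvanishing_minors N" and N: "N > 0" and K: "K \<subseteq> {0..<N}"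
  shows "principal_minor (fourier_matrix N) K \<noteq> 0"
proof -
  define \<omega> where "\<omega> = exp (- 2 * of_real pi * \<i> / of_nat N)"
  have \<omega>: "primitive_root_unity N \<omega>" unfolding \<omega>_def by (rule primitive_root_unity_exp[OF N])
  have \<omega>N: "\<omega> ^ N = 1" using \<omega> by (simp add: primitive_root_unity_def)
  have "algebraic_int \<omega>"
  proof (rule algebraic_int_root[where y = 1 and p = "monom 1 N"])
    show "\<forall>i. coeff (monom (1 :: complex) N) i \<in> \<int>" by simp
  qed (use N \<omega>N in \<open>simp_all add: poly_monom degree_monom_eq\<close>)
  then obtain z where z: "\<omega> = complex_of_alg z" using Abs_alg_int_inverse by (metis mem_Collect_eq)
  have prim: "primitive_root_unity N z"
    using \<omega> unfolding z primitive_root_unity_def by (simp flip: complex_of_alg.hom_power)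
  have sub: "{i. i < N \<and> i \<in> K} = K" using K by auto
  have "pick K i < N" if "i < card K" for i
    using pick_in_set_le[OF that] K by auto
  then have "submatrix (fourier_matrix N) K K = family_mat (\<lambda>a b. complex_of_alg (z ^ (a * b))) K"
    unfolding submatrix_def family_mat_def fourier_matrix_def \<omega>_def[symmetric] z
    by (intro eq_matI) (auto simp: sub complex_of_alg.hom_power)
  then have "principal_minor (fourier_matrix N) K = complex_of_alg (det (family_mat (\<lambda>a b. z ^ (a * b)) K))"
    unfolding principal_minor_def complex_of_alg.hom_det_family_mat by simp
  moreover have "K \<subseteq> {..<N}" using K by auto
  ultimately show ?thesis using good prim by (simp add: nonvanishing_minors_def)
qed

theorem theorem1p5:
  fixes N k :: nat and p P :: "nat \<Rightarrow> nat"
  assumes "k \<ge> 1"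
    and "\<And>i. i \<in> {1..k} \<Longrightarrow> prime (p i)"
    and "strict_mono_on {1..k} p"
    and "N = (\<Prod>i=1..k. p i)"
    and "\<And>j. P j = (\<Prod>i=1..j. p i)"
    and "\<And>j. j \<in> {1..<k} \<Longrightarrow>
           real (p (j + 1)) > (real (P j) / 2) powr (real (P j * totient (P j)) / 4)"
  shows "\<forall>K \<subseteq> {0..<N}. principal_minor (fourier_matrix N) K \<noteq> 0"
proof -
  have pos: "P j > 0" if "j \<le> k" for j
    unfolding assms(5) using assms(2) that by (intro prod_pos) (auto simp: prime_gt_0_nat)
  have "nonvanishing_minors (P j)" if "j \<le> k" for j
    using that
  proof (induction j)
    case 0
    then show ?case using nonvanishing_minors_1 by (simp add: assms(5))
  next
    case (Suc j)
    have prime: "prime (p (Suc j))" using assms(2) Suc.prems by simp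
    have "coprime (p i) (p (Suc j))" if "i \<in> {1..j}" for i
      using strict_mono_onD[OF assms(3), of i "Suc j"] that Suc.prems assms(2)
      by (intro primes_coprime) auto
    then have "coprime (P j) (p (Suc j))"
      unfolding assms(5) by (rule prod_coprime_left)
    moreover have "real (p (Suc j)) > (real (P j) / 2) powr (real (P j * totient (P j)) / 4)"
    \<comment> \<open>The growth assumption starts at \<open>j = 1\<close>. For the empty product
      the bound is (1/2)^(1/4), which is below every prime.\<close>
    proof (cases "j = 0")
      case True
      have "(1 / 2 :: real) powr (1 / 4) \<le> 1" by (intro powr_le1) auto
      also have "1 < real (p (Suc j))" using prime_gt_1_nat[OF prime] by simp
      finally show ?thesis using True by (simp add: assms(5))
    next
      case False
      then show ?thesis using assms(6)[of j] Suc.prems by simp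
    qed
    moreover have "P (Suc j) = P j * p (Suc j)" by (simp add: assms(5))
    ultimately show ?case
      using nonvanishing_minors_mult_prime[of "P j" "p (Suc j)"] Suc pos[of j] prime by simp
  qed
  then have "nonvanishing_minors (P k)" "P k > 0" using pos by auto
  moreover have "N = P k" using assms(4,5) by simp
  ultimately show ?thesis using principal_minor_fourier_nonzero by blast
qed

end
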